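(* Let $f \in \mathbb{Z}[X_1, X_2]$ be a polynomial irreducible over $\mathbb{Q}$, of degree $d_1$ in $X_1$ and degree $d_2 \ge 1$ in $X_2$. Then for all $B_1 \ge 1$ and $B_2 \ge 2$, \[ N_{\mathrm{rat}}(f, B_1, B_2) \ll_{d_1, d_2} B_1^{2/d_2} (\log B_2)^2 . \]
   Context: The height of a rational number $t = x/y$ in lowest terms is $H(t) = \max(|x|,|y|)$. $N_{\mathrm{rat}}(f,B_1,B_2)$ is the number of $(x_1,x_2)\in\mathbb{Q}^2$ with $f(x_1,x_2)=0$, $H(x_1)\le B_1$ and $H(x_2)\le B_2$. $U \ll_\rho V$ means $|U|\le cV$ for a positive constant $c$ depending only on $\rho$. *)

theory Defs
  imports Complex_Main "HOL-Computational_Algebra.Polynomial_Factorial"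
begin

(* Bivariate polynomials f(X1,X2) are represented as  int poly poly :
   the outer variable is X2, the coefficients are polynomials in X1. *)

definition rat_height :: "rat \<Rightarrow> int" where
  "rat_height t = (case quotient_of t of (a, b) \<Rightarrow> max \<bar>a\<bar> \<bar>b\<bar>)"

definition eval2 :: "int poly poly \<Rightarrow> rat \<Rightarrow> rat \<Rightarrow> rat" where
  "eval2 f x1 x2 = poly (map_poly (\<lambda>c. poly (map_poly of_int c) x1) f) x2"

definition degX1 :: "int poly poly \<Rightarrow> nat" where
  "degX1 f = Max ((\<lambda>i. degree (coeff f i)) ` {..degree f})"

definition degX2 :: "int poly poly \<Rightarrow> nat" where
  "degX2 f = degree f"

definition irreducible_over_Q :: "int poly poly \<Rightarrow> bool" where
  "irreducible_over_Q f = irreducible (map_poly (map_poly (of_int :: int \<Rightarrow> rat)) f)"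

definition N_rat :: "int poly poly \<Rightarrow> real \<Rightarrow> real \<Rightarrow> nat" where
  "N_rat f B1 B2 = card {(x1, x2). eval2 f x1 x2 = 0 \<and>
      real_of_int (rat_height x1) \<le> B1 \<and> real_of_int (rat_height x2) \<le> B2}"

end

theory Submission
  imports Defs "HOL-Computational_Algebra.Field_as_Ring" "HOL-Library.FuncSet" "HOL-Number_Theory.Cong"
begin

text \<open>
  The determinant method of Bombieri-Pila and Heath-Brown, in a form where determinants are
  replaced by the pigeonhole principle. Put $L = \log B_2$ and let $p$ be a prime slightly larger
  than a constant times $B_1^{2/d_2}$. The points of the curve that reduce modulo $p$ to a given
  point with $\partial f / \partial X_2 \not\equiv 0$ have $X_2$-coordinate equal, modulo any power
  of $p$, to a polynomial in $X_1$. By pigeonhole some small nonzero $g$ of bidegree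
  $(M, d_2 - 1)$, with $M$ about $L$, is divisible by $p^n$ at all these points, where
  $n = (M + 1) d_2$; its homogenized values are smaller than $p^n$, so $g$ vanishes there,
  and elimination leaves $O(L)$ points in the class.

  Three devices make this uniform. If $f$ has large coefficients then it may be replaced by a
  proportional equation with coefficients polynomial in $B_1 B_2$, or else all points lie on a second
  curve of the same bidegree. Hence the discriminant is nonzero modulo suitable primes of size
  $O(B_1^{2/d_2} L)$, which exist because $\mathrm{lcm}(1, \ldots, N) \ge 2^{N-1}$; using these
  primes costs the second logarithm. Finally, $d_2$ primes are used: an $x_1$ at which all of them are
  bad lies in $O(1)$ classes modulo a number exceeding $2 B_1^2$, and each class contains at most one
  $x_1$ of height at most $B_1$.
\<close>

section \<open>Small integer solutions of linear systems\<close>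

text \<open>The exponent \<open>2 / d2\<close> comes from a balance of sizes. Let n = (M + 1) d2 be
  the number of coefficients of the auxiliary polynomial. Pigeonhole makes them at most p^((n+1)/2),
  so its homogenized values are at most n p^((n+1)/2) B1^M B2^(d2-1), which must stay below p^n. The
  degree d2 - 1 in X_2 keeps f from dividing the auxiliary polynomial; its price, a fixed power of
  B2, is exp(O(M)) as soon as M is at least L. After taking M-th roots, p^(d2/2) need only exceed a
  constant times B1. With p = O(B1^(2/d2) L) there are O(p) classes of O(L) points each, hence the
  two logarithms. Since d2 such primes have a product exceeding a constant times B1^2, d2 of them
  separate the remaining x_1.

  All logarithms, in particular that of the discriminant, must be O(L), so ln B1 must be O(L). If B1
  > B2^d2 and d2 \<ge> 2, counting the x_2 alone gives O(B2^2), which is below B1^(2/d2); for d2 =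
  1, counting the x_1 suffices.\<close>

lemma sum_fun_upd_other:
  fixes h :: "'j \<Rightarrow> int"
  assumes "finite J" "j0 \<notin> J"
  shows "(\<Sum>j\<in>insert j0 J. r j * (if j = j0 then x else h j)) = r j0 * x + (\<Sum>j\<in>J. r j * h j)"
proof -
  have "(\<Sum>j\<in>J. r j * (if j = j0 then x else h j)) = (\<Sum>j\<in>J. r j * h j)"
    by (rule sum.cong) (use assms in auto)
  then show ?thesis using assms by simp
qed

text \<open>Fraction-free elimination with pivot \<open>r e0 j0\<close>: the remaining unknowns are
  multiplied by the pivot, so that row \<open>e0\<close> can be solved for the unknown
  \<open>j0\<close> without division.\<close>

lemma pivot_kernel:
  fixes r :: "'e \<Rightarrow> 'j \<Rightarrow> int"
  assumes "finite J" "j0 \<notin> J"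
    and "(\<Sum>j\<in>J. (r e0 j0 * r e j - r e j0 * r e0 j) * v j) = 0"
  shows "(\<Sum>j\<in>insert j0 J. r e j * (if j = j0 then - (\<Sum>j\<in>J. r e0 j * v j) else r e0 j0 * v j)) = 0"
proof -
  have "0 = r e0 j0 * (\<Sum>j\<in>J. r e j * v j) - r e j0 * (\<Sum>j\<in>J. r e0 j * v j)"
    using assms(3) by (simp add: sum_distrib_left algebra_simps sum_subtractf)
  moreover have "(\<Sum>j\<in>J. r e j * (r e0 j0 * v j)) = r e0 j0 * (\<Sum>j\<in>J. r e j * v j)"
    by (simp add: sum_distrib_left algebra_simps)
  ultimately show ?thesis
    by (subst sum_fun_upd_other[OF assms(1,2)]) (simp add: algebra_simps)
qed

text \<open>Induction on the set of unknowns: if \<open>j0\<close> occurs in no equation, its unit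
  vector is a solution; otherwise eliminating \<open>j0\<close> removes one unknown and one
  equation, so the strict inequality survives.\<close>

lemma kernel_exists:
  fixes r :: "'e \<Rightarrow> 'j \<Rightarrow> int"
  assumes "finite J" "finite E" "card E < card J"
  shows "\<exists>v :: 'j \<Rightarrow> int. (\<exists>j\<in>J. v j \<noteq> 0) \<and> (\<forall>e\<in>E. (\<Sum>j\<in>J. r e j * v j) = 0)"
  using assms
proof (induction J arbitrary: E r rule: finite_induct)
  case empty
  then show ?case by simp
next
  case (insert j0 J)
  show ?case
  proof (cases "\<forall>e\<in>E. r e j0 = 0")
    case True
    then show ?thesis using insert.hyps
      by (intro exI[of _ "\<lambda>j. if j = j0 then 1 else 0"])
        (auto simp: sum_fun_upd_other[OF insert.hyps, of _ _ "\<lambda>_. 0"])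
  next
    case False
    then obtain e0 where e0: "e0 \<in> E" "r e0 j0 \<noteq> 0" by blast
    have "card (E - {e0}) < card J"
      using insert.prems insert.hyps e0 card_gt_0_iff[of E] by (auto simp: card_Diff_singleton_if)
    then obtain v where v: "\<exists>j\<in>J. v j \<noteq> 0"
      "\<forall>e\<in>E - {e0}. (\<Sum>j\<in>J. (r e0 j0 * r e j - r e j0 * r e0 j) * v j) = 0"
      using insert.IH[of "E - {e0}" "\<lambda>e j. r e0 j0 * r e j - r e j0 * r e0 j"] insert.prems by auto
    have *: "(\<Sum>j\<in>J. (r e0 j0 * r e j - r e j0 * r e0 j) * v j) = 0" if "e \<in> E" for e
      using v(2) that by (cases "e = e0") auto
    define w where "w = (\<lambda>j. if j = j0 then - (\<Sum>j\<in>J. r e0 j * v j) else r e0 j0 * v j)"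
    have "(\<Sum>j\<in>insert j0 J. r e j * w j) = 0" if "e \<in> E" for e
      unfolding w_def using *[OF that] insert.hyps by (intro pivot_kernel) auto
    moreover obtain j where "j \<in> J" "v j \<noteq> 0" using v(1) by blast
    then have "\<exists>j\<in>insert j0 J. w j \<noteq> 0"
      using e0(2) insert.hyps by (intro bexI[of _ j]) (auto simp: w_def)
    ultimately show ?thesis by blast
  qed
qed

text \<open>Eliminating an unknown turns entries of size \<open>H\<close> into 2 by 2 minors of size
  at most \<open>2 * H\<^sup>2\<close>, and back substitution is charged the factor
  \<open>Suc n * H\<close>. The growth in \<open>n\<close> is harmless: \<open>n\<close> will depend
  on the degrees alone, and for fixed \<open>n\<close> the bound is polynomial in
  \<open>H\<close>.\<close>

primrec kernel_bound :: "nat \<Rightarrow> real \<Rightarrow> real" where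
  "kernel_bound 0 H = 1"
| "kernel_bound (Suc n) H = real (Suc n) * H * kernel_bound n (2 * H\<^sup>2)"

lemma kernel_bound_ge_1: "H \<ge> 1 \<Longrightarrow> kernel_bound n H \<ge> 1"
proof (induction n arbitrary: H)
  case (Suc n)
  have "H\<^sup>2 \<ge> 1" using Suc.prems by simp
  then have "kernel_bound n (2 * H\<^sup>2) \<ge> 1" by (intro Suc.IH) linarith
  moreover have "real (Suc n) * H \<ge> 1" using Suc.prems mult_mono[of 1 "real (Suc n)" 1 H] by simp
  ultimately show ?case using mult_mono[of 1 "real (Suc n) * H" 1] by simp
qed simp

lemma kernel_bound_polynomial:
  "\<exists>A\<ge>1. \<exists>k. \<forall>H\<ge>1. kernel_bound n H \<le> A * H ^ k"
proof (induction n)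
  case 0
  then show ?case by (intro exI[of _ 1] conjI exI[of _ 0]) auto
next
  case (Suc n)
  then obtain A k where A: "A \<ge> 1" "\<And>H. H \<ge> 1 \<Longrightarrow> kernel_bound n H \<le> A * H ^ k" by blast
  have "kernel_bound (Suc n) H \<le> (real (Suc n) * A * 2 ^ k) * H ^ (2 * k + 1)" if "H \<ge> 1" for H
  proof -
    have "H\<^sup>2 \<ge> 1" using that by simp
    then have "kernel_bound n (2 * H\<^sup>2) \<le> A * (2 * H\<^sup>2) ^ k" by (intro A) linarith
    then have "kernel_bound (Suc n) H \<le> real (Suc n) * H * (A * (2 * H\<^sup>2) ^ k)"
      using that by (simp del: of_nat_Suc add: mult_left_mono)
    also have "\<dots> = (real (Suc n) * A * 2 ^ k) * H ^ (2 * k + 1)"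
      by (simp add: power_mult_distrib power_mult[symmetric] mult_ac)
    finally show ?thesis .
  qed
  moreover have "real (Suc n) * A * 2 ^ k \<ge> 1"
  proof -
    have "1 * 1 \<le> real (Suc n) * A" using A(1) by (intro mult_mono) auto
    then have "1 * 1 \<le> (real (Suc n) * A) * 2 ^ k" by (intro mult_mono) auto
    then show ?thesis by simp
  qed
  ultimately show ?case by blast
qed

text \<open>Solvability is assumed instead of deduced from a count of the equations, and the bound
  involves only the number of unknowns. So \<open>E\<close> may be any set: in
  \<open>small_height_equation\<close> there is one equation for each rational point, and the given
  curve provides the solution.\<close>

lemma small_kernel:
  fixes r :: "'e \<Rightarrow> 'j \<Rightarrow> int"
  assumes "finite J" "H \<ge> 1" "\<And>e j. e \<in> E \<Longrightarrow> j \<in> J \<Longrightarrow> \<bar>real_of_int (r e j)\<bar> \<le> H"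
    and "\<exists>v :: 'j \<Rightarrow> int. (\<exists>j\<in>J. v j \<noteq> 0) \<and> (\<forall>e\<in>E. (\<Sum>j\<in>J. r e j * v j) = 0)"
  shows "\<exists>v :: 'j \<Rightarrow> int. (\<exists>j\<in>J. v j \<noteq> 0) \<and> (\<forall>j\<in>J. \<bar>real_of_int (v j)\<bar> \<le> kernel_bound (card J) H)
            \<and> (\<forall>e\<in>E. (\<Sum>j\<in>J. r e j * v j) = 0)"
  using assms
proof (induction J arbitrary: H r rule: finite_induct)
  case empty
  then show ?case by simp
next
  case (insert j0 J)
  have H: "H \<ge> 1" by fact
  then have H2: "2 * H\<^sup>2 \<ge> 1" using one_le_power[of H 2] by linarith
  note bd = insert.prems(2)
  show ?case
  proof (cases "\<forall>e\<in>E. r e j0 = 0")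
    case True
    then show ?thesis using insert.hyps kernel_bound_ge_1[OF H, of "card (insert j0 J)"]
      by (intro exI[of _ "\<lambda>j. if j = j0 then 1 else 0"])
        (auto simp: sum_fun_upd_other[OF insert.hyps, of _ _ "\<lambda>_. 0"])
  next
    case False
    then obtain e0 where e0: "e0 \<in> E" "r e0 j0 \<noteq> 0" by blast
    define r' where "r' = (\<lambda>e j. r e0 j0 * r e j - r e j0 * r e0 j)"
    obtain u where u: "\<exists>j\<in>insert j0 J. u j \<noteq> 0" "\<forall>e\<in>E. (\<Sum>j\<in>insert j0 J. r e j * u j) = 0"
      using insert.prems(3) by blast
    have u': "r e j0 * u j0 + (\<Sum>j\<in>J. r e j * u j) = 0" if "e \<in> E" for e
      using u(2) that insert.hyps by auto
    \<comment> \<open>A solution supported at \<open>j0\<close> alone would violate equation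
      \<open>e0\<close>, whose coefficient at \<open>j0\<close> is nonzero.\<close>
    have "\<exists>j\<in>J. u j \<noteq> 0"
    proof (rule ccontr)
      assume *: "\<not> ?thesis"
      then have "r e0 j0 * u j0 = 0" using u'[OF e0(1)] by simp
      then show False using e0(2) u(1) * by auto
    qed
    moreover have "(\<Sum>j\<in>J. r' e j * u j) = 0" if "e \<in> E" for e
    proof -
      have "(\<Sum>j\<in>J. r' e j * u j) = r e0 j0 * (\<Sum>j\<in>J. r e j * u j) - r e j0 * (\<Sum>j\<in>J. r e0 j * u j)"
        by (simp add: r'_def sum_distrib_left algebra_simps sum_subtractf)
      also have "(\<Sum>j\<in>J. r e j * u j) = - r e j0 * u j0" using u'[OF that] by linarith
      also have "(\<Sum>j\<in>J. r e0 j * u j) = - r e0 j0 * u j0" using u'[OF e0(1)] by linarith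
      finally show ?thesis by simp
    qed
    moreover have r'_bd: "\<bar>real_of_int (r' e j)\<bar> \<le> 2 * H\<^sup>2" if "e \<in> E" "j \<in> J" for e j
    proof -
      have "\<bar>real_of_int (r' e j)\<bar> \<le> \<bar>real_of_int (r e0 j0 * r e j)\<bar> + \<bar>real_of_int (r e j0 * r e0 j)\<bar>"
        unfolding r'_def of_int_diff by (rule abs_triangle_ineq4)
      also have "\<dots> \<le> H * H + H * H"
        unfolding of_int_mult abs_mult using bd e0 that H by (intro add_mono mult_mono) auto
      finally show ?thesis by (simp add: power2_eq_square)
    qed
    ultimately obtain v where v: "\<exists>j\<in>J. v j \<noteq> 0" 
      "\<And>j. j \<in> J \<Longrightarrow> \<bar>real_of_int (v j)\<bar> \<le> kernel_bound (card J) (2 * H\<^sup>2)"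
      "\<And>e. e \<in> E \<Longrightarrow> (\<Sum>j\<in>J. r' e j * v j) = 0"
      using insert.IH[of "2 * H\<^sup>2" r'] H2 by blast
    define K where "K = kernel_bound (card J) (2 * H\<^sup>2)"
    have K: "K \<ge> 1" unfolding K_def by (rule kernel_bound_ge_1[OF H2])
    have full: "kernel_bound (card (insert j0 J)) H = real (Suc (card J)) * (H * K)"
      using insert.hyps by (simp add: K_def)
    have HK: "H * K \<ge> 0" using H K by simp
    define w where "w = (\<lambda>j. if j = j0 then - (\<Sum>j\<in>J. r e0 j * v j) else r e0 j0 * v j)"
    have "\<bar>real_of_int (w j)\<bar> \<le> kernel_bound (card (insert j0 J)) H" if "j \<in> insert j0 J" for j
    proof (cases "j = j0")
      case True
      have "\<bar>real_of_int (w j)\<bar> \<le> (\<Sum>j\<in>J. \<bar>real_of_int (r e0 j * v j)\<bar>)"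
        unfolding w_def using True by (simp del: of_int_mult add: sum_abs)
      also have "\<dots> \<le> (\<Sum>j\<in>J. H * K)"
        unfolding of_int_mult abs_mult K_def using bd e0 H v(2) by (intro sum_mono mult_mono) auto
      also have "\<dots> = real (card J) * (H * K)" by simp
      also have "\<dots> \<le> real (Suc (card J)) * (H * K)" using HK by (intro mult_right_mono) auto
      finally show ?thesis by (simp only: full)
    next
      case False
      have "\<bar>real_of_int (w j)\<bar> = \<bar>real_of_int (r e0 j0)\<bar> * \<bar>real_of_int (v j)\<bar>"
        using False by (simp add: w_def abs_mult)
      also have "\<dots> \<le> 1 * (H * K)"
        unfolding K_def using False that bd e0 H v(2) by (simp add: mult_mono)
      also have "\<dots> \<le> real (Suc (card J)) * (H * K)" using HK by (intro mult_right_mono) auto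
      finally show ?thesis by (simp only: full)
    qed
    moreover have "(\<Sum>j\<in>insert j0 J. r e j * w j) = 0" if "e \<in> E" for e
      unfolding w_def using v(3)[OF that] insert.hyps unfolding r'_def by (intro pivot_kernel) auto
    moreover have "\<exists>j\<in>insert j0 J. w j \<noteq> 0"
      using v(1) e0(2) insert.hyps by (auto simp: w_def)
    ultimately show ?thesis by blast
  qed
qed

section \<open>Bivariate polynomials and elimination\<close>

lemma map_poly_hom_add:
  assumes "h 0 = 0" "\<And>a b. h (a + b) = h a + h b"
  shows "map_poly h (p + q) = map_poly h p + map_poly h q"
  by (rule poly_eqI) (simp add: coeff_map_poly assms)

lemma map_poly_hom_mult:
  assumes "h 0 = 0" "\<And>a b. h (a + b) = h a + h b" "\<And>a b. h (a * b) = h a * h b"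
  shows "map_poly h (p * q) = map_poly h p * map_poly h q"
proof -
  have "h (sum u A) = (\<Sum>i\<in>A. h (u i))" if "finite A" for u and A :: "nat set"
    using that by (induction A rule: finite_induct) (simp_all add: assms)
  then show ?thesis
    by (intro poly_eqI) (simp add: coeff_map_poly coeff_mult assms)
qed

abbreviation rat_poly :: "int poly \<Rightarrow> rat poly" where
  "rat_poly \<equiv> map_poly of_int"

abbreviation rat_poly2 :: "int poly poly \<Rightarrow> rat poly poly" where
  "rat_poly2 \<equiv> map_poly rat_poly"

lemma rat_poly_add: "rat_poly (p + q) = rat_poly p + rat_poly q"
  by (rule map_poly_hom_add) auto

lemma rat_poly_mult: "rat_poly (p * q) = rat_poly p * rat_poly q"
  by (rule map_poly_hom_mult) auto

lemma rat_poly2_add: "rat_poly2 (p + q) = rat_poly2 p + rat_poly2 q"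
  by (rule map_poly_hom_add) (auto simp: rat_poly_add)

lemma rat_poly2_mult: "rat_poly2 (p * q) = rat_poly2 p * rat_poly2 q"
  by (rule map_poly_hom_mult) (auto simp: rat_poly_add rat_poly_mult)

lemma rat_poly_eq_0_iff [simp]: "rat_poly p = 0 \<longleftrightarrow> p = 0"
  by (rule map_poly_eq_0_iff) auto

lemma rat_poly2_eq_0_iff [simp]: "rat_poly2 p = 0 \<longleftrightarrow> p = 0"
  by (rule map_poly_eq_0_iff) auto

lemma degree_rat_poly [simp]: "degree (rat_poly p) = degree p"
  by (rule degree_map_poly) auto

lemma degree_rat_poly2 [simp]: "degree (rat_poly2 p) = degree p"
  by (rule degree_map_poly) auto

lemma rat_poly2_pderiv: "rat_poly2 (pderiv p) = pderiv (rat_poly2 p)"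
proof (rule poly_eqI)
  fix n
  have "rat_poly (of_nat k) = of_nat k" for k
    by (induction k) (auto simp: rat_poly_add map_poly_1')
  then show "coeff (rat_poly2 (pderiv p)) n = coeff (pderiv (rat_poly2 p)) n"
    unfolding coeff_pderiv coeff_map_poly[of rat_poly, OF map_poly_0] rat_poly_mult by metis
qed

section \<open>Evaluation, bidegree and coefficient size of bivariate polynomials\<close>

definition eval_xy :: "'a::comm_ring_1 poly poly \<Rightarrow> 'a \<Rightarrow> 'a \<Rightarrow> 'a" where
  "eval_xy f x y = poly (poly f [:y:]) x"

lemma eval_xy_simps [simp]:
  "eval_xy 0 x y = 0" "eval_xy (f + g) x y = eval_xy f x y + eval_xy g x y"
  "eval_xy (f - g) x y = eval_xy f x y - eval_xy g x y"
  "eval_xy (f * g) x y = eval_xy f x y * eval_xy g x y" "eval_xy [:R:] x y = poly R x"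
  by (simp_all add: eval_xy_def)

lemma eval_xy_sum [simp]: "eval_xy (sum f A) x y = (\<Sum>i\<in>A. eval_xy (f i) x y)"
  by (induction A rule: infinite_finite_induct) auto

lemma eval_xy_monom [simp]: "eval_xy (monom (monom c i) j) x y = c * x ^ i * y ^ j"
  by (simp add: eval_xy_def poly_monom)

lemma eval_xy_conv_section: "eval_xy f x y = poly (map_poly (\<lambda>c. poly c x) f) y"
proof (induction f)
  case (pCons a f)
  then show ?case by (simp add: eval_xy_def map_poly_pCons)
qed simp

lemma eval2_conv_eval_xy: "eval2 f x y = eval_xy (rat_poly2 f) x y"
  unfolding eval2_def eval_xy_conv_section by (simp add: map_poly_map_poly o_def)

definition bideg_le :: "'a::zero poly poly \<Rightarrow> nat \<Rightarrow> nat \<Rightarrow> bool" where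
  "bideg_le f m e \<longleftrightarrow> degree f \<le> e \<and> (\<forall>j. degree (coeff f j) \<le> m)"

lemma bideg_le_mono: "bideg_le f m e \<Longrightarrow> m \<le> m' \<Longrightarrow> e \<le> e' \<Longrightarrow> bideg_le f m' e'"
  by (auto simp: bideg_le_def intro: order_trans)

lemma bideg_le_coeff_eq_0: "bideg_le f m e \<Longrightarrow> \<not> (i \<le> m \<and> j \<le> e) \<Longrightarrow> coeff (coeff f j) i = 0"
  by (metis bideg_le_def coeff_0 coeff_eq_0 le_less_trans not_le)

definition coeffs_le :: "int poly poly \<Rightarrow> real \<Rightarrow> bool" where
  "coeffs_le f H \<longleftrightarrow> (\<forall>i j. \<bar>real_of_int (coeff (coeff f j) i)\<bar> \<le> H)"

lemma coeffs_le_mono: "coeffs_le f H \<Longrightarrow> H \<le> H' \<Longrightarrow> coeffs_le f H'"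
  by (auto simp: coeffs_le_def intro: order_trans)

lemma exists_coeffs_le: "\<exists>H\<ge>1. coeffs_le f H"
proof -
  define S where "S = (\<lambda>(i, j). coeff (coeff f j) i) ` ({..Max (degree ` coeff f ` {..degree f})} \<times> {..degree f}) \<union> {0}"
  have fin: "finite S" by (simp add: S_def)
  have "coeff (coeff f j) i \<in> S" for i j
  proof (cases "coeff (coeff f j) i = 0")
    case False
    then have ij: "i \<le> degree (coeff f j)" "j \<le> degree f" by (auto intro: le_degree)
    have "degree (coeff f j) \<le> Max (degree ` coeff f ` {..degree f})"
      using ij(2) by (intro Max_ge) auto
    then have "(i, j) \<in> {..Max (degree ` coeff f ` {..degree f})} \<times> {..degree f}"
      unfolding mem_Times_iff atMost_iff fst_conv snd_conv using ij by (blast intro: order_trans)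
    then show ?thesis unfolding S_def by (intro UnI1) (rule rev_image_eqI, auto)
  qed (simp add: S_def)
  then have "coeffs_le f (Max ((\<lambda>c. \<bar>real_of_int c\<bar>) ` S) + 1)"
    unfolding coeffs_le_def using fin by (meson Max_ge finite_imageI imageI add_increasing2 order_trans zero_le_one order_refl)
  moreover have "Max ((\<lambda>c. \<bar>real_of_int c\<bar>) ` S) \<ge> 0"
    by (rule Max_ge) (use fin in \<open>auto simp: S_def\<close>)
  ultimately show ?thesis by (intro exI[of _ "Max ((\<lambda>c. \<bar>real_of_int c\<bar>) ` S) + 1"]) auto
qed

text \<open>Index pairs list the exponent of X_1 first, whereas \<open>coeff\<close> reaches X_2,
  the outer variable, first.\<close>

definition bipoly :: "nat \<Rightarrow> nat \<Rightarrow> (nat \<times> nat \<Rightarrow> 'a) \<Rightarrow> 'a::comm_ring_1 poly poly" where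
  "bipoly m e v = (\<Sum>ij\<in>{..m} \<times> {..e}. monom (monom (v ij) (fst ij)) (snd ij))"

lemma coeff_bipoly: "coeff (coeff (bipoly m e v) j) i = (if i \<le> m \<and> j \<le> e then v (i, j) else 0)"
proof -
  have "coeff (coeff (bipoly m e v) j) i = (\<Sum>kl\<in>{..m} \<times> {..e}. if kl = (i, j) then v kl else 0)"
    unfolding bipoly_def coeff_sum by (intro sum.cong) (auto simp: prod_eq_iff)
  then show ?thesis by simp
qed

lemma bideg_le_bipoly: "bideg_le (bipoly m e v) m e"
  unfolding bideg_le_def by (auto intro!: degree_le simp: coeff_bipoly poly_eq_iff)

lemma bipoly_coeffs: "bideg_le f m e \<Longrightarrow> bipoly m e (\<lambda>(i, j). coeff (coeff f j) i) = f"
  using bideg_le_coeff_eq_0[of f m e] by (force simp: poly_eq_iff coeff_bipoly)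

lemma eval_xy_bipoly: "eval_xy (bipoly m e v) x y = (\<Sum>ij\<in>{..m} \<times> {..e}. v ij * x ^ fst ij * y ^ snd ij)"
  by (simp add: bipoly_def)

lemma eval_xy_altdef:
  "bideg_le f m e \<Longrightarrow>
    eval_xy f x y = (\<Sum>ij\<in>{..m} \<times> {..e}. coeff (coeff f (snd ij)) (fst ij) * x ^ fst ij * y ^ snd ij)"
  using eval_xy_bipoly[of m e "\<lambda>(i, j). coeff (coeff f j) i" x y] by (simp add: bipoly_coeffs case_prod_beta)

lemma bideg_le_rat_poly2 [simp]: "bideg_le (rat_poly2 f) m e \<longleftrightarrow> bideg_le f m e"
  by (simp add: bideg_le_def coeff_map_poly)

text \<open>Entry of a Sylvester-type matrix: the coefficient of the monomial \<open>IJ\<close> in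
  the product of \<open>f\<close> with the monomial \<open>ij\<close>.\<close>

definition shifted_coeff :: "int poly poly \<Rightarrow> nat \<times> nat \<Rightarrow> nat \<times> nat \<Rightarrow> int" where
  "shifted_coeff f IJ ij =
     (if fst ij \<le> fst IJ \<and> snd ij \<le> snd IJ then coeff (coeff f (snd IJ - snd ij)) (fst IJ - fst ij) else 0)"

lemma coeff_bipoly_mult:
  "coeff (coeff (bipoly m e v * f) J) I = (\<Sum>ij\<in>{..m} \<times> {..e}. shifted_coeff f (I, J) ij * v ij)"
  unfolding bipoly_def sum_distrib_right coeff_sum
  by (intro sum.cong) (auto simp: coeff_monom_mult shifted_coeff_def)

lemma bideg_le_mult:
  fixes f g :: "'a::comm_ring_1 poly poly"
  assumes "bideg_le f m e" "bideg_le g m' e'"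
  shows "bideg_le (f * g) (m + m') (e + e')"
proof -
  have "degree (coeff f i * coeff g j) \<le> m + m'" for i j
    using assms by (meson bideg_le_def add_mono degree_mult_le order_trans)
  then have "degree (coeff (f * g) k) \<le> m + m'" for k
    unfolding coeff_mult by (intro degree_sum_le) auto
  moreover have "degree (f * g) \<le> e + e'"
    using assms by (meson bideg_le_def add_mono degree_mult_le order_trans)
  ultimately show ?thesis by (simp add: bideg_le_def)
qed

text \<open>The coefficients of $a$ and $b$ solve a linear system: all coefficients of $a f + b g$ at
  positive powers of $X_2$ vanish. The system has more unknowns than equations.\<close>

lemma elimination:
  fixes f g :: "int poly poly"
  assumes irr: "irreducible (rat_poly2 f)" and d: "degree f = d" "d \<ge> 1"
    and bi: "bideg_le f M d" "bideg_le g M d" and ndvd: "\<not> rat_poly2 f dvd rat_poly2 g"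
    and H: "coeffs_le f H" "coeffs_le g H" "H \<ge> 1"
  defines "n \<equiv> 2 * (d * (2 * d * M + 1))"
  shows "\<exists>a b R. a * f + b * g = [:R:] \<and> R \<noteq> 0 \<and> degree R \<le> (2 * d + 1) * M
           \<and> (\<forall>i. \<bar>real_of_int (coeff R i)\<bar> \<le> real n * (H * kernel_bound n H))"
proof -
  \<comment> \<open>There are \<open>2 * d * (m + 1)\<close> unknowns and
    \<open>(m + M + 1) * (2 * d - 1)\<close> equations. The difference is m + M + 1 - 2dM, which
    this choice of \<open>m\<close> makes positive.\<close>
  define m where "m = 2 * d * M"
  define J :: "(bool \<times> nat \<times> nat) set" where "J = UNIV \<times> {..m} \<times> {..d-1}"
  define E :: "(nat \<times> nat) set" where "E = {..m + M} \<times> {1..2*d-1}"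
  define r where "r = (\<lambda>IJ (s, ij). shifted_coeff (if s then f else g) IJ ij)"
  have [simp]: "finite J" "finite E" by (simp_all add: J_def E_def)
  have cardJ: "card J = n"
    using d(2) by (simp add: J_def card_cartesian_product n_def m_def card_UNIV_bool)
  have "(m + M + 1) * (2 * d - 1) < 2 * (d * (m + 1))"
  proof -
    obtain k where k: "d = Suc k" using d(2) by (cases d) auto
    show ?thesis unfolding m_def k by (simp add: algebra_simps)
  qed
  then have "card E < card J" by (simp add: cardJ E_def card_cartesian_product n_def m_def)
  then have "\<exists>u. (\<exists>j\<in>J. u j \<noteq> 0) \<and> (\<forall>e\<in>E. (\<Sum>j\<in>J. r e j * u j) = 0)"
    by (intro kernel_exists) auto
  moreover have r_bd: "\<bar>real_of_int (r e j)\<bar> \<le> H" for e j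
    using H by (auto simp: r_def shifted_coeff_def coeffs_le_def split: prod.splits)
  ultimately have "\<exists>v. (\<exists>j\<in>J. v j \<noteq> 0) \<and> (\<forall>j\<in>J. \<bar>real_of_int (v j)\<bar> \<le> kernel_bound (card J) H)
      \<and> (\<forall>e\<in>E. (\<Sum>j\<in>J. r e j * v j) = 0)"
    by (intro small_kernel[OF \<open>finite J\<close> H(3)])
  then obtain v :: "bool \<times> nat \<times> nat \<Rightarrow> int" where
    v: "\<exists>j\<in>J. v j \<noteq> 0" "\<forall>j\<in>J. \<bar>real_of_int (v j)\<bar> \<le> kernel_bound n H"
      "\<forall>e\<in>E. (\<Sum>j\<in>J. r e j * v j) = 0"
    unfolding cardJ by (elim exE conjE)
  define a where "a = bipoly m (d-1) (\<lambda>ij. v (True, ij))"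
  define b where "b = bipoly m (d-1) (\<lambda>ij. v (False, ij))"
  have co: "coeff (coeff (a * f + b * g) l) k = (\<Sum>j\<in>J. r (k, l) j * v j)" for k l
    unfolding coeff_add a_def b_def coeff_bipoly_mult J_def
    by (subst sum.cartesian_product') (simp add: UNIV_bool r_def add.commute)
  have ab: "bideg_le a m (d-1)" "bideg_le b m (d-1)"
    by (simp_all add: a_def b_def bideg_le_bipoly)
  have "bideg_le (a * f) (m + M) (d - 1 + d)" "bideg_le (b * g) (m + M) (d - 1 + d)"
    by (intro bideg_le_mult ab bi)+
  then have bi_sum: "bideg_le (a * f + b * g) (m + M) (2 * d - 1)"
    using d(2) by (auto simp: bideg_le_def intro!: degree_add_le)
  define R where "R = coeff (a * f + b * g) 0"
  have "coeff (a * f + b * g) l = 0" if "l \<ge> 1" for l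
  proof (rule poly_eqI)
    fix k
    show "coeff (coeff (a * f + b * g) l) k = coeff 0 k"
    proof (cases "k \<le> m + M \<and> l \<le> 2 * d - 1")
      case True
      then show ?thesis using bspec[OF v(3), of "(k, l)"] that by (simp add: co E_def del: coeff_add)
    next
      case False
      then show ?thesis using bideg_le_coeff_eq_0[OF bi_sum False] by simp
    qed
  qed
  then have eq: "a * f + b * g = [:R:]"
    by (intro poly_eqI) (simp add: R_def coeff_pCons del: coeff_add split: nat.splits)
  \<comment> \<open>If \<open>R\<close> were zero, the prime element \<open>f\<close> would divide
    the product of \<open>b\<close> and \<open>g\<close>, hence \<open>b\<close>, whose degree in
    X_2 is smaller. So \<open>b\<close> and then \<open>a\<close> would vanish, against the
    nontriviality of the solution.\<close>
  have "R \<noteq> 0"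
  proof
    assume "R = 0"
    then have "rat_poly2 (a * f + b * g) = 0" using eq by simp
    then have z: "rat_poly2 a * rat_poly2 f + rat_poly2 b * rat_poly2 g = 0"
      by (simp only: rat_poly2_add rat_poly2_mult)
    then have "rat_poly2 b * rat_poly2 g = rat_poly2 f * (- rat_poly2 a)"
      by (simp add: algebra_simps eq_neg_iff_add_eq_0)
    then have "rat_poly2 f dvd rat_poly2 b * rat_poly2 g" by simp
    moreover have "prime_elem (rat_poly2 f)" using irr by (rule irreducible_imp_prime_poly)
    ultimately have "rat_poly2 f dvd rat_poly2 b" using ndvd by (auto simp: prime_elem_dvd_mult_iff)
    moreover have "degree (rat_poly2 b) < degree (rat_poly2 f)"
      using ab(2) d unfolding bideg_le_def degree_rat_poly2 by linarith
    ultimately have b0: "b = 0" by (metis dvd_imp_degree_le leD rat_poly2_eq_0_iff)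
    then have a0: "a = 0" using z irr by auto
    have "v (s, i, j) = 0" if "i \<le> m" "j \<le> d - 1" for s i j
      using a0 b0 that coeff_bipoly[of m "d-1" "\<lambda>ij. v (True, ij)" j i]
        coeff_bipoly[of m "d-1" "\<lambda>ij. v (False, ij)" j i]
      by (cases s) (auto simp: a_def b_def)
    then show False using v(1) by (auto simp: J_def)
  qed
  moreover have "degree R \<le> (2 * d + 1) * M"
    using bi_sum by (simp add: R_def bideg_le_def m_def algebra_simps)
  moreover have "\<bar>real_of_int (coeff R i)\<bar> \<le> real n * (H * kernel_bound n H)" for i
  proof -
    have "\<bar>real_of_int (coeff R i)\<bar> = \<bar>\<Sum>j\<in>J. real_of_int (r (i, 0) j * v j)\<bar>"
      by (simp only: R_def co of_int_sum)
    also have "\<dots> \<le> (\<Sum>j\<in>J. \<bar>real_of_int (r (i, 0) j * v j)\<bar>)" by (rule sum_abs)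
    also have "\<dots> \<le> (\<Sum>j\<in>J. H * kernel_bound n H)"
      unfolding of_int_mult abs_mult using r_bd v(2) H(3) by (intro sum_mono mult_mono) auto
    finally show ?thesis by (simp add: cardJ)
  qed
  ultimately show ?thesis using eq by blast
qed

text \<open>If the specialization vanished, the nonunit X_1 - x would divide the irreducible
  \<open>F\<close>, which would leave a cofactor of degree 0 in X_2. Thus the curve contains no
  vertical line.\<close>

lemma section_nonzero:
  assumes irr: "irreducible F" and "degree F \<ge> 1"
  shows "map_poly (\<lambda>c. poly c (x::rat)) F \<noteq> 0"
proof
  assume "map_poly (\<lambda>c. poly c x) F = 0"
  then have "poly (coeff F n) x = 0" for n
    by (metis coeff_0 coeff_map_poly poly_0)
  then have "[:[:- x, 1:]:] dvd F" unfolding const_poly_dvd_iff by (simp add: poly_eq_0_iff_dvd)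
  then obtain h where h: "F = [:[:- x, 1:]:] * h" by (elim dvdE)
  moreover have "\<not> is_unit [:[:- x, 1:]:]" by (simp add: is_unit_const_poly_iff is_unit_poly_iff)
  ultimately have "is_unit h" using irr irreducibleD by blast
  then have "degree h = 0" by (auto simp: is_unit_poly_iff)
  then show False using assms(2) h by simp
qed

lemma card_section_le:
  assumes irr: "irreducible F" and "degree F \<ge> 1"
  shows "finite {y. eval_xy F (x::rat) y = 0}" "card {y. eval_xy F x y = 0} \<le> degree F"
proof -
  have *: "map_poly (\<lambda>c. poly c x) F \<noteq> 0" by (rule section_nonzero[OF assms])
  show "finite {y. eval_xy F (x::rat) y = 0}"
    unfolding eval_xy_conv_section by (rule poly_roots_finite[OF *])
  have "card {y. eval_xy F x y = 0} \<le> degree (map_poly (\<lambda>c. poly c x) F)"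
    unfolding eval_xy_conv_section by (rule card_poly_roots_bound[OF *])
  also have "\<dots> \<le> degree F" by (rule map_poly_degree_leq)
  finally show "card {y. eval_xy F x y = 0} \<le> degree F" .
qed

lemma card_fibration_le:
  assumes "finite A" "card A \<le> k" "\<And>x. x \<in> A \<Longrightarrow> finite (B x) \<and> card (B x) \<le> l"
    and "S \<subseteq> Sigma A B"
  shows "finite S" "card S \<le> k * l"
proof -
  have fin: "finite (Sigma A B)" using assms by auto
  then show "finite S" using assms(4) by (rule finite_subset[rotated])
  have "card S \<le> card (Sigma A B)" by (rule card_mono[OF fin assms(4)])
  also have "\<dots> = (\<Sum>x\<in>A. card (B x))" using assms by (intro card_SigmaI) auto
  also have "\<dots> \<le> card A * l" using assms by (intro sum_bounded_above[where K = l, simplified]) auto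
  also have "\<dots> \<le> k * l" using assms by simp
  finally show "card S \<le> k * l" .
qed

text \<open>A weak form of Bezout's theorem: the eliminant \<open>R\<close> vanishes at the
  X_1-coordinates of all common zeros, and above each of them there are at most \<open>d\<close>
  points of \<open>f\<close>. Coefficient sizes do not matter here, so any bound for them may be fed
  to \<open>elimination\<close>.\<close>

lemma common_zeros:
  fixes f g :: "int poly poly"
  assumes irr: "irreducible (rat_poly2 f)" and d: "degree f = d" "d \<ge> 1"
    and bi: "bideg_le f M d" "bideg_le g M d" and ndvd: "\<not> rat_poly2 f dvd rat_poly2 g"
    and S: "\<And>x y. (x, y) \<in> S \<Longrightarrow> eval_xy (rat_poly2 f) x y = 0 \<and> eval_xy (rat_poly2 g) x y = 0"
  shows "finite S" "card S \<le> ((2 * d + 1) * M) * d"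
proof -
  obtain H1 H2 where H: "H1 \<ge> 1" "coeffs_le f H1" "H2 \<ge> 1" "coeffs_le g H2" using exists_coeffs_le by meson
  then have "coeffs_le f (max H1 H2)" "coeffs_le g (max H1 H2)" "max H1 H2 \<ge> 1"
    by (auto intro: coeffs_le_mono)
  then obtain a b R where R: "a * f + b * g = [:R:]" "R \<noteq> 0" "degree R \<le> (2 * d + 1) * M"
    using elimination[OF irr d bi ndvd] by blast
  define A where "A = {x. poly (rat_poly R) x = 0}"
  have R0: "rat_poly R \<noteq> 0" using R(2) by simp
  have "poly (rat_poly R) x = 0" if "(x, y) \<in> S" for x y
  proof -
    have "rat_poly2 (a * f + b * g) = [:rat_poly R:]" unfolding R(1) using R(2) by (simp add: map_poly_pCons)
    then have "eval_xy (rat_poly2 a * rat_poly2 f + rat_poly2 b * rat_poly2 g) x y = poly (rat_poly R) x"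
      by (simp only: rat_poly2_add rat_poly2_mult eval_xy_simps)
    then show ?thesis using S[OF that] by simp
  qed
  then have "S \<subseteq> Sigma A (\<lambda>x. {y. eval_xy (rat_poly2 f) x y = 0})" using S by (auto simp: A_def)
  moreover have "finite A" unfolding A_def by (rule poly_roots_finite[OF R0])
  moreover have "card A \<le> (2 * d + 1) * M"
    using card_poly_roots_bound[OF R0] R(3) by (auto simp: A_def)
  moreover have "finite {y. eval_xy (rat_poly2 f) x y = 0} \<and> card {y. eval_xy (rat_poly2 f) x y = 0} \<le> d" for x
    using card_section_le[OF irr, of x] d by simp
  ultimately show "finite S" "card S \<le> ((2 * d + 1) * M) * d"
    using card_fibration_le[of A "(2 * d + 1) * M" "\<lambda>x. {y. eval_xy (rat_poly2 f) x y = 0}" d S] by blast+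
qed

section \<open>Primes up to N and roots modulo a prime\<close>

text \<open>The entries $1 / ((n+1)\binom{n}{k})$ of the Leibniz harmonic triangle are differences of entries
  to the left and above, so induction on $k$ clears their denominators.\<close>

lemma lcm_upto_over_binomial_Ints:
  "n + 1 \<le> N \<Longrightarrow> k \<le> n \<Longrightarrow> real (Lcm {1..N}) / (real (n + 1) * real (n choose k)) \<in> \<int>"
proof (induction k arbitrary: n)
  case 0
  then have "(n + 1) dvd Lcm {1..N}" by (intro dvd_Lcm) auto
  then obtain c where "Lcm {1..N} = (n + 1) * c" by (elim dvdE)
  then have "real (Lcm {1..N}) = real (n + 1) * real c" by (metis of_nat_mult)
  then show ?case by simp
next
  case (Suc k)
  then obtain n' where n: "n = Suc n'" by (cases n) auto
  define c where "c = real n * real (n' choose k)"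
  have "real (Suc k * (n choose Suc k)) = real (n * (n' choose k))"
    by (subst binomial_absorption) (simp add: n)
  then have c1: "real (n choose Suc k) = c / real (Suc k)"
    by (simp add: c_def field_simps)
  have "real ((n - k) * (n choose k)) = real (n * (n' choose k))"
    by (subst binomial_absorb_comp) (simp add: n)
  then have c2: "real (n choose k) = c / (real n - real k)"
    using Suc.prems by (simp add: c_def field_simps of_nat_diff)
  have "c \<noteq> 0" using Suc.prems n by (simp add: c_def)
  define L where "L = real (Lcm {1..N})"
  have "L / (real (n + 1) * real (n choose Suc k))
      = L / (real (n' + 1) * real (n' choose k)) - L / (real (n + 1) * real (n choose k))"
  proof -
    have "real (n' + 1) * real (n' choose k) = c" by (simp add: c_def n)
    moreover have "real n - real k \<noteq> 0" using Suc.prems by simp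
    moreover have "1 + real k \<noteq> 0" "1 + real n \<noteq> 0" by linarith+
    ultimately show ?thesis using \<open>c \<noteq> 0\<close> unfolding c1 c2
      by (simp add: divide_simps) (simp add: algebra_simps)
  qed
  moreover have "L / (real (n' + 1) * real (n' choose k)) \<in> \<int>" "L / (real (n + 1) * real (n choose k)) \<in> \<int>"
    unfolding L_def using Suc.prems n by (intro Suc.IH; simp)+
  ultimately show ?case unfolding L_def by simp
qed

text \<open>Each \<open>N * ((N - 1) choose k)\<close> divides the least common multiple, and over
  the \<open>N\<close> values of \<open>k\<close> these numbers have average
  \<open>2 ^ (N - 1)\<close>.\<close>

lemma two_power_le_lcm_upto:
  assumes "N \<ge> 1"
  shows "2 ^ (N - 1) \<le> Lcm {1..N::nat}"
proof (rule ccontr)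
  assume neg: "\<not> ?thesis"
  have pos: "Lcm {1..N} > 0" by (auto intro!: Nat.gr0I simp: Lcm_0_iff)
  have bd: "N * ((N - 1) choose k) < 2 ^ (N - 1)" if "k \<le> N - 1" for k
  proof -
    have nz: "real N * real ((N - 1) choose k) > 0" using that assms by simp
    have "real (Lcm {1..N}) / (real N * real ((N - 1) choose k)) \<in> \<int>"
      using lcm_upto_over_binomial_Ints[of "N - 1" N k] that assms by simp
    then obtain z :: int where z: "real (Lcm {1..N}) / (real N * real ((N - 1) choose k)) = of_int z"
      by (elim Ints_cases)
    moreover have "real (Lcm {1..N}) / (real N * real ((N - 1) choose k)) > 0" using nz pos by simp
    ultimately have "z \<ge> 1" by simp
    then have "real (Lcm {1..N}) / (real N * real ((N - 1) choose k)) \<ge> 1" unfolding z by simp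
    then have "real N * real ((N - 1) choose k) \<le> real (Lcm {1..N})" using nz by (simp add: field_simps)
    then have "N * ((N - 1) choose k) \<le> Lcm {1..N}" by (metis of_nat_le_iff of_nat_mult)
    then show ?thesis using neg by linarith
  qed
  have "N * 2 ^ (N - 1) = (\<Sum>k\<le>N - 1. N * ((N - 1) choose k))"
    by (simp add: sum_distrib_left[symmetric] choose_row_sum)
  also have "\<dots> < (\<Sum>k\<le>N - 1. 2 ^ (N - 1))" using bd by (intro sum_strict_mono) auto
  also have "\<dots> = N * 2 ^ (N - 1)" using assms by simp
  finally show False by simp
qed

text \<open>The multiplicity of \<open>p\<close> in a least common multiple is the maximum of the
  multiplicities, so \<open>p ^ e\<close> already divides one of the numbers up to
  \<open>N\<close>.\<close>

lemma prime_power_dvd_lcm_upto: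
  assumes "prime p" "p ^ e dvd Lcm {1..N::nat}" "N \<ge> 1"
  shows "p ^ e \<le> N"
  using assms(3,2)
proof (induction N rule: dec_induct)
  case base
  then show ?case by (simp add: dvd_imp_le)
next
  case (step N)
  have eq: "Lcm {1..Suc N} = lcm (Suc N) (Lcm {1..N})"
    using step.hyps by (simp add: atLeastAtMostSuc_conv)
  have nz: "Lcm {1..N} \<noteq> 0" by (auto simp: Lcm_0_iff)
  have "e \<le> multiplicity p (lcm (Suc N) (Lcm {1..N}))"
    using step.prems assms(1) nz unfolding eq by (intro multiplicity_geI) auto
  then have "e \<le> multiplicity p (Suc N) \<or> e \<le> multiplicity p (Lcm {1..N})"
    using nz assms(1) by (subst (asm) multiplicity_lcm) auto
  then show ?case
  proof
    assume "e \<le> multiplicity p (Suc N)"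
    then have "p ^ e dvd Suc N" by (rule multiplicity_dvd')
    then show ?case by (intro dvd_imp_le) auto
  next
    assume "e \<le> multiplicity p (Lcm {1..N})"
    then show ?case using step.IH by (simp add: multiplicity_dvd' le_SucI)
  qed
qed

lemma prod_primes_le:
  assumes "finite P" "\<And>p. p \<in> P \<Longrightarrow> prime p \<and> p dvd D" "D > (0::nat)"
  shows "\<Prod>P \<le> D"
proof -
  have "\<Prod>P dvd D"
    using assms(1,2)
  proof (induction P rule: finite_induct)
    case (insert p P)
    have "coprime p (\<Prod>P)"
      using insert by (intro prod_coprime_right) (auto intro!: primes_coprime)
    then show ?case using insert by (simp add: divides_mult)
  qed simp
  then show ?thesis using assms(3) by (rule dvd_imp_le)
qed

text \<open>The least common multiple of the numbers up to \<open>N\<close> is split by primes.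
  Those up to \<open>Y\<close>, and those above \<open>Y\<close> prime to \<open>D\<close>,
  contribute at most \<open>N\<close> each. Those above \<open>Y\<close> that divide
  \<open>D\<close> occur to the first power only, because \<open>N \<le> Y\<^sup>2\<close>, and
  together contribute at most \<open>D\<close>. With only \<open>k\<close> primes of the second kind
  the product would be below \<open>2 ^ (N - 1)\<close>.\<close>

lemma card_primes_not_dvd:
  assumes "N \<ge> 1" "N \<le> Y\<^sup>2" "D > 0" "N ^ (Y + k) * D < 2 ^ (N - 1)"
  shows "k < card {p::nat. prime p \<and> Y < p \<and> p \<le> N \<and> \<not> p dvd D}" (is "_ < card ?Q")
proof (rule ccontr)
  assume "\<not> ?thesis"
  then have cQ: "card ?Q \<le> k" by simp
  define \<Lambda> where "\<Lambda> = Lcm {1..N}"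
  have nz: "\<Lambda> \<noteq> 0" by (auto simp: \<Lambda>_def Lcm_0_iff)
  define P where "P = prime_factors \<Lambda>"
  have [simp]: "finite P" by (simp add: P_def)
  have pw: "p ^ multiplicity p \<Lambda> \<le> N" if "p \<in> P" for p
    using that assms(1) unfolding P_def \<Lambda>_def
    by (intro prime_power_dvd_lcm_upto) (auto simp: multiplicity_dvd)
  have P: "prime p \<and> p \<le> N" if "p \<in> P" for p
    using that assms(1) prime_power_dvd_lcm_upto[of p 1 N] by (auto simp: P_def \<Lambda>_def in_prime_factors_iff)
  define P1 P2 P3 where "P1 = {p \<in> P. p \<le> Y}" and "P2 = {p \<in> P. Y < p \<and> \<not> p dvd D}"
    and "P3 = {p \<in> P. Y < p \<and> p dvd D}"
  have part: "P = P1 \<union> (P2 \<union> P3)" "P1 \<inter> (P2 \<union> P3) = {}" "P2 \<inter> P3 = {}"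
    by (auto simp: P1_def P2_def P3_def)
  have [simp]: "finite P1" "finite P2" "finite P3" by (simp_all add: P1_def P2_def P3_def)
  let ?h = "\<lambda>p. p ^ multiplicity p \<Lambda>"
  have "\<Lambda> = prod ?h P" unfolding P_def using nz by (intro prime_factorization_nat) simp
  also have "\<dots> = prod ?h P1 * (prod ?h P2 * prod ?h P3)"
    using part by (simp add: prod.union_disjoint)
  also have "\<dots> \<le> N ^ Y * (N ^ k * D)"
  proof (intro mult_mono)
    have "prod ?h P1 \<le> N ^ card P1" using pw part(1) prod_mono[of P1 ?h "\<lambda>_. N"] by (auto simp: prod_constant)
    also have "card P1 \<le> card {1..Y}" using P by (intro card_mono) (auto simp: P1_def Suc_le_eq intro!: prime_gt_0_nat)
    then have "N ^ card P1 \<le> N ^ Y" using assms(1) by (intro power_increasing) auto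
    finally show "prod ?h P1 \<le> N ^ Y" .
    have "prod ?h P2 \<le> N ^ card P2" using pw part(1) prod_mono[of P2 ?h "\<lambda>_. N"] by (auto simp: prod_constant)
    also have "card P2 \<le> card ?Q" using P by (intro card_mono) (auto simp: P2_def)
    then have "N ^ card P2 \<le> N ^ k" using assms(1) cQ by (intro power_increasing) auto
    finally show "prod ?h P2 \<le> N ^ k" .
    have "?h p = p" if "p \<in> P3" for p
    proof -
      have "p \<in> P" "Y < p" using that by (auto simp: P3_def)
      then have "multiplicity p \<Lambda> \<ge> 1" using nz P[of p]
        by (intro multiplicity_geI) (auto simp: P_def in_prime_factors_iff)
      moreover have "multiplicity p \<Lambda> < 2"
      proof (rule ccontr)
        assume "\<not> ?thesis"
        then have "p ^ 2 \<le> p ^ multiplicity p \<Lambda>" using P[OF \<open>p \<in> P\<close>] prime_gt_0_nat[of p] by (intro power_increasing) auto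
        also have "\<dots> \<le> N" by (rule pw) fact
        also have "\<dots> \<le> Y\<^sup>2" by fact
        finally show False using \<open>Y < p\<close> by (simp add: power2_nat_le_eq_le)
      qed
      ultimately show ?thesis by (simp add: le_antisym numeral_2_eq_2 less_Suc_eq_le)
    qed
    then have "prod ?h P3 = \<Prod>P3" by (intro prod.cong) auto
    also have "\<dots> \<le> D" using P assms(3) by (intro prod_primes_le) (auto simp: P3_def)
    finally show "prod ?h P3 \<le> D" .
  qed auto
  finally have "\<Lambda> \<le> N ^ (Y + k) * D" by (simp add: power_add mult_ac)
  also have "\<dots> < 2 ^ (N - 1)" by fact
  also have "\<dots> \<le> \<Lambda>" unfolding \<Lambda>_def by (rule two_power_le_lcm_upto[OF assms(1)])
  finally show False by simp
qed

text \<open>Lagrange's bound, proved over the integers: dividing by X - r leaves the remainder h(r),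
  which is 0 modulo \<open>p\<close>, so the quotient again has a coefficient prime to
  \<open>p\<close>.\<close>

lemma roots_mod_prime:
  fixes h :: "int poly" and p :: int
  assumes p: "prime p" and "degree h \<le> d" "\<exists>i. \<not> p dvd coeff h i"
  shows "card {x \<in> {0..<p}. p dvd poly h x} \<le> d"
  using assms(2,3)
proof (induction d arbitrary: h)
  case 0
  then obtain i where i: "\<not> p dvd coeff h i" by blast
  from 0 have "degree h = 0" by simp
  then obtain c where "h = [:c:]" by (rule degree_eq_zeroE)
  then have "{x \<in> {0..<p}. p dvd poly h x} = {}" using i by (cases i) auto
  then show ?case by (metis card.empty le_refl)
next
  case (Suc d)
  show ?case
  proof (cases "{x \<in> {0..<p}. p dvd poly h x} = {}")
    case True
    then show ?thesis by (metis card.empty le0)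
  next
    case False
    then obtain r where r: "r \<in> {0..<p}" "p dvd poly h r" by auto
    define q where "q = synthetic_div h r"
    have h: "h = [:- r, 1:] * q + [:poly h r:]"
      unfolding q_def by (rule synthetic_div_correct'[symmetric])
    have "\<exists>i. \<not> p dvd coeff q i"
    proof (rule ccontr)
      assume "\<not> ?thesis"
      then have "[:p:] dvd q" by (auto simp: const_poly_dvd_iff)
      then have "[:p:] dvd [:- r, 1:] * q + [:poly h r:]" using r(2) by (intro dvd_add dvd_mult) auto
      then have "\<forall>i. p dvd coeff h i" unfolding h[symmetric] by (simp add: const_poly_dvd_iff)
      then show False using Suc.prems by blast
    qed
    moreover have "degree q \<le> d" using Suc.prems by (simp add: q_def degree_synthetic_div)
    ultimately have "card {x \<in> {0..<p}. p dvd poly q x} \<le> d" by (rule Suc.IH[rotated])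
    moreover have "{x \<in> {0..<p}. p dvd poly h x} \<subseteq> insert r {x \<in> {0..<p}. p dvd poly q x}"
    proof
      fix x assume x: "x \<in> {x \<in> {0..<p}. p dvd poly h x}"
      have "poly h x = (x - r) * poly q x + poly h r" by (subst h) (simp add: algebra_simps)
      then have "p dvd (x - r) * poly q x" using x r(2) by (simp add: dvd_add_left_iff)
      then have "p dvd x - r \<or> p dvd poly q x" using p by (simp add: prime_dvd_mult_iff)
      moreover have "x = r" if "p dvd x - r"
      proof (rule ccontr)
        assume "x \<noteq> r"
        then have "p \<le> \<bar>x - r\<bar>" using that dvd_imp_le_int[of "x - r" p] x r(1) by auto
        then show False using x r(1) by auto
      qed
      ultimately show "x \<in> insert r {x \<in> {0..<p}. p dvd poly q x}" using x by auto
    qed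
    then have "card {x \<in> {0..<p}. p dvd poly h x} \<le> card (insert r {x \<in> {0..<p}. p dvd poly q x})"
      by (intro card_mono finite.insertI finite_subset[of "{x \<in> {0..<p}. p dvd poly q x}" "{0..<p}"]) auto
    moreover have "card (insert r {x \<in> {0..<p}. p dvd poly q x}) \<le> Suc (card {x \<in> {0..<p}. p dvd poly q x})"
      by (subst card_insert_if) (auto intro: finite_subset[of _ "{0..<p}"])
    ultimately show ?thesis by linarith
  qed
qed

section \<open>Auxiliary polynomials modulo prime powers\<close>

lemma poly_taylor2:
  fixes f :: "'a::idom poly"
  shows "\<exists>r. poly f (y + d) = poly f y + d * poly (pderiv f) y + d\<^sup>2 * r"
proof (induction f)
  case 0
  then show ?case by (intro exI[of _ 0]) simp
next
  case (pCons a f)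
  then obtain r where r: "poly f (y + d) = poly f y + d * poly (pderiv f) y + d\<^sup>2 * r" by blast
  show ?case
    by (intro exI[of _ "poly (pderiv f) y + (y + d) * r"])
      (simp only: poly_pCons r pderiv_pCons poly_add, simp add: algebra_simps power2_eq_square)
qed

lemma eval_xy_taylor2:
  fixes f :: "int poly poly"
  shows "\<exists>r. eval_xy f x (y + d) = eval_xy f x y + d * eval_xy (pderiv f) x y + d\<^sup>2 * r"
proof -
  obtain r where "poly f ([:y:] + [:d:]) = poly f [:y:] + [:d:] * poly (pderiv f) [:y:] + [:d:]\<^sup>2 * r"
    using poly_taylor2 by blast
  then have "poly (poly f ([:y:] + [:d:])) x = poly (poly f [:y:] + [:d:] * poly (pderiv f) [:y:] + [:d:]\<^sup>2 * r) x"
    by simp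
  then show ?thesis by (intro exI[of _ "poly r x"]) (simp add: eval_xy_def)
qed

lemma poly_poly_conv_eval_xy: "poly (poly f \<phi>) x = eval_xy f x (poly \<phi> x)"
  unfolding eval_xy_def by (induction f) simp_all

lemma eval_xy_cong:
  fixes f :: "int poly poly"
  assumes "[x = x'] (mod q)" "[y = y'] (mod q)"
  shows "[eval_xy f x y = eval_xy f x' y'] (mod q)"
proof -
  have "bideg_le f (Max ((\<lambda>j. degree (coeff f j)) ` {..degree f})) (degree f)"
    unfolding bideg_le_def
  proof (intro conjI allI)
    fix j
    show "degree (coeff f j) \<le> Max ((\<lambda>j. degree (coeff f j)) ` {..degree f})"
      by (cases "j \<le> degree f") (auto intro!: Max_ge simp: coeff_eq_0)
  qed simp
  note eq = eval_xy_altdef[OF this]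
  show ?thesis unfolding eq by (intro cong_sum cong_mult cong_pow assms cong_refl)
qed

text \<open>Newton's iteration, run in the ring of polynomials in $X_1$ with the derivative frozen at
  $(\alpha, \beta)$, gains one factor of $p$ per step.\<close>

lemma newton_approximation:
  fixes f :: "int poly poly" and p :: int
  assumes p: "prime p" and ns: "\<not> p dvd eval_xy (pderiv f) \<alpha> \<beta>"
  shows "\<exists>\<phi>. \<forall>x y. [x = \<alpha>] (mod p) \<longrightarrow> [y = \<beta>] (mod p) \<longrightarrow> p ^ Suc k dvd eval_xy f x y \<longrightarrow>
           p ^ Suc k dvd y - poly \<phi> x"
proof (induction k)
  case 0
  show ?case by (intro exI[of _ "[:\<beta>:]"]) (auto simp: cong_iff_dvd_diff)
next
  case (Suc k)
  then obtain \<phi> where \<phi>: "\<And>x y. [x = \<alpha>] (mod p) \<Longrightarrow> [y = \<beta>] (mod p) \<Longrightarrow>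
      p ^ Suc k dvd eval_xy f x y \<Longrightarrow> p ^ Suc k dvd y - poly \<phi> x" by blast
  \<comment> \<open>One inverse \<open>u\<close> of the derivative modulo \<open>p\<close> serves
    all points of the class, which makes the Newton step
    \<open>\<phi> - [:u:] * poly f \<phi>\<close> a single polynomial in X_1.\<close>
  have "coprime (eval_xy (pderiv f) \<alpha> \<beta>) p"
    using p ns by (simp add: coprime_commute prime_imp_coprime)
  then obtain u where u: "[eval_xy (pderiv f) \<alpha> \<beta> * u = 1] (mod p)"
    using cong_solve_coprime_int by blast
  have "p ^ Suc (Suc k) dvd y - poly (\<phi> - [:u:] * poly f \<phi>) x"
    if xy: "[x = \<alpha>] (mod p)" "[y = \<beta>] (mod p)" "p ^ Suc (Suc k) dvd eval_xy f x y" for x y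
  proof -
    define z where "z = poly \<phi> x"
    define d where "d = y - z"
    have d: "p ^ Suc k dvd d"
      unfolding d_def z_def using xy by (intro \<phi>) (auto intro: dvd_trans[OF le_imp_power_dvd])
    obtain r where r: "eval_xy f x (z + d) = eval_xy f x z + d * eval_xy (pderiv f) x z + d\<^sup>2 * r"
      using eval_xy_taylor2 by blast
    have "p dvd d" using d by (auto intro: dvd_trans[of p "p ^ Suc k"])
    then have "[y = z] (mod p)" by (simp add: cong_iff_dvd_diff d_def)
    then have "[z = \<beta>] (mod p)" using xy(2) by (meson cong_sym cong_trans)
    then have "[eval_xy (pderiv f) x z * u = eval_xy (pderiv f) \<alpha> \<beta> * u] (mod p)"
      using xy(1) by (intro cong_mult eval_xy_cong cong_refl)
    then have "[1 = eval_xy (pderiv f) x z * u] (mod p)" using u by (meson cong_sym cong_trans)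
    then have e: "p dvd 1 - eval_xy (pderiv f) x z * u" by (simp add: cong_iff_dvd_diff)
    have "y - poly (\<phi> - [:u:] * poly f \<phi>) x = d + u * eval_xy f x z"
      by (simp add: poly_poly_conv_eval_xy d_def z_def)
    also have "eval_xy f x z = eval_xy f x y - d * eval_xy (pderiv f) x z - d\<^sup>2 * r"
      using r by (simp add: d_def)
    \<comment> \<open>Each of the three terms gains the extra factor \<open>p\<close>: the first
      because \<open>u\<close> inverts the derivative at \<open>(x, z)\<close> too, the second by
      the hypothesis on \<open>(x, y)\<close>, the third because \<open>d\<close> occurs
      twice.\<close>
    also have "d + u * \<dots> = d * (1 - eval_xy (pderiv f) x z * u) + u * eval_xy f x y - d * d * (u * r)"
      by (simp add: algebra_simps power2_eq_square)
    finally have eq: "y - poly (\<phi> - [:u:] * poly f \<phi>) x = \<dots>" .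
    have h: "p ^ Suc k * p dvd d * (1 - eval_xy (pderiv f) x z * u)" "p ^ Suc k * p dvd d * d"
      using d e \<open>p dvd d\<close> by (intro mult_dvd_mono; simp)+
    have pw: "p ^ Suc (Suc k) = p ^ Suc k * p" by simp
    show ?thesis unfolding eq
      using dvd_diff[OF dvd_add[OF h(1) dvd_mult[OF xy(3)[unfolded pw]]] dvd_mult2[OF h(2)]] unfolding pw .
  qed
  then show ?case by blast
qed

lemma sum_triangle: "2 * (\<Sum>k<n. n - k) = n * (n + 1)" for n :: nat
proof (induction n)
  case (Suc n)
  have "(\<Sum>k<Suc n. Suc n - k) = (\<Sum>k<n. Suc (n - k)) + 1"
    by (simp add: Suc_diff_le)
  also have "\<dots> = (\<Sum>k<n. n - k) + n + 1" by (simp add: sum_Suc)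
  finally show ?case using Suc by simp
qed simp

text \<open>The exponents n - k add up to n(n+1)/2, so there are at most
  \<open>(q ^ (n + 1)) ^ n\<close> tuples of residues; a box with more than
  \<open>q ^ (n + 1)\<close> integers in each of its \<open>n\<close> coordinates contains two
  vectors with the same residues. The root \<open>q\<close> of \<open>p\<close> is there because
  (n+1)/2 may be half an odd number.\<close>

lemma small_vector_in_flag_lattice:
  fixes l :: "nat \<Rightarrow> 'i \<Rightarrow> int" and p :: int and q :: real
  assumes "finite I" and n: "n = card I" "n \<ge> 1" and p: "p \<ge> 1" and q: "q \<ge> 0" "q\<^sup>2 = of_int p"
  shows "\<exists>w :: 'i \<Rightarrow> int. (\<exists>i\<in>I. w i \<noteq> 0) \<and> (\<forall>i\<in>I. \<bar>real_of_int (w i)\<bar> \<le> q ^ (n + 1))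
           \<and> (\<forall>k<n. p ^ (n - k) dvd (\<Sum>i\<in>I. w i * l k i))"
proof -
  \<comment> \<open>The range {0..h} has h + 1 elements, strictly more than
    \<open>q ^ (n + 1)\<close>, while differences of its elements are at most
    \<open>h\<close>.\<close>
  define h where "h = \<lfloor>q ^ (n + 1)\<rfloor>"
  have h: "h \<ge> 0" "of_int h \<le> q ^ (n + 1)" "q ^ (n + 1) < of_int (h + 1)"
    using q by (simp_all add: h_def)
  define A where "A = (\<Pi>\<^sub>E i\<in>I. {0..h})"
  define B where "B = (\<Pi>\<^sub>E k\<in>{..<n}. {0..<p ^ (n - k)})"
  define \<Phi> where "\<Phi> = (\<lambda>w. \<lambda>k\<in>{..<n}. (\<Sum>i\<in>I. w i * l k i) mod p ^ (n - k))"
  have finB: "finite B" unfolding B_def by (intro finite_PiE) auto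
  have sub: "\<Phi> ` A \<subseteq> B" using p by (auto simp: \<Phi>_def B_def split: if_split_asm)
  have "real (card B) = (\<Prod>k<n. real (nat (p ^ (n - k))))"
    unfolding B_def by (subst card_PiE) auto
  also have "\<dots> = (\<Prod>k<n. (q\<^sup>2) ^ (n - k))" using p q by (intro prod.cong) auto
  also have "\<dots> = q ^ (2 * (\<Sum>k<n. n - k))" by (simp only: power_sum power_mult)
  also have "\<dots> = (q ^ (n + 1)) ^ n" by (simp only: sum_triangle power_mult[symmetric] mult.commute)
  also have "\<dots> < of_int (h + 1) ^ n" using h(3) n(2) q(1) by (intro power_strict_mono) auto
  also have "\<dots> = real (card A)" unfolding A_def using \<open>finite I\<close> h(1) n(1) by (subst card_PiE) auto
  finally have "card B < card A" by simp
  then have "card (\<Phi> ` A) < card A" using card_mono[OF finB sub] by linarith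
  then have "\<not> inj_on \<Phi> A" by (rule pigeonhole)
  then obtain v v' where v: "v \<in> A" "v' \<in> A" "v \<noteq> v'" "\<Phi> v = \<Phi> v'" by (auto simp: inj_on_def)
  define w where "w = (\<lambda>i. v i - v' i)"
  have "\<exists>i\<in>I. w i \<noteq> 0"
  proof (rule ccontr)
    assume "\<not> ?thesis"
    then have "v = v'" using v(1,2) unfolding A_def by (intro PiE_ext) (auto simp: w_def)
    then show False using v(3) by simp
  qed
  moreover have "\<bar>real_of_int (w i)\<bar> \<le> q ^ (n + 1)" if "i \<in> I" for i
  proof -
    have "v i \<in> {0..h}" "v' i \<in> {0..h}" using v(1,2) that by (auto simp: A_def)
    then have "\<bar>w i\<bar> \<le> h" by (auto simp: w_def)
    then show ?thesis using h(2) by linarith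
  qed
  moreover have "p ^ (n - k) dvd (\<Sum>i\<in>I. w i * l k i)" if "k < n" for k
  proof -
    have "(\<Sum>i\<in>I. v i * l k i) mod p ^ (n - k) = (\<Sum>i\<in>I. v' i * l k i) mod p ^ (n - k)"
      using fun_cong[OF v(4), of k] that by (simp add: \<Phi>_def)
    then have "p ^ (n - k) dvd (\<Sum>i\<in>I. v i * l k i) - (\<Sum>i\<in>I. v' i * l k i)"
      by (simp add: mod_eq_dvd_iff)
    then show ?thesis by (simp add: w_def left_diff_distrib sum_subtractf)
  qed
  ultimately show ?thesis by blast
qed

text \<open>On the class \<open>y\<close> may be replaced by \<open>poly \<phi> x\<close> modulo
  \<open>p ^ n\<close>, which turns \<open>g\<close> into a polynomial in x - \<alpha>. Its k-th
  term already contains (x - \<alpha>)^k, a multiple of \<open>p ^ k\<close>, so only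
  \<open>p ^ (n - k)\<close> is required of the k-th coefficient, and nothing for
  \<open>k \<ge> n\<close>. This saving halves the exponent in the size of \<open>g\<close>.\<close>

lemma auxiliary_polynomial:
  fixes f :: "int poly poly" and p :: int and q :: real and M e :: nat
  assumes p: "prime p" and ns: "\<not> p dvd eval_xy (pderiv f) \<alpha> \<beta>"
    and q: "q \<ge> 0" "q\<^sup>2 = of_int p"
  defines "n \<equiv> (M + 1) * (e + 1)"
  shows "\<exists>g. g \<noteq> 0 \<and> bideg_le g M e \<and> coeffs_le g (q ^ (n + 1)) \<and>
     (\<forall>x y. [x = \<alpha>] (mod p) \<longrightarrow> [y = \<beta>] (mod p) \<longrightarrow> p ^ n dvd eval_xy f x y \<longrightarrow> p ^ n dvd eval_xy g x y)"
proof -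
  have n1: "n \<ge> 1" by (simp add: n_def)
  obtain \<phi> where \<phi>: "\<And>x y. [x = \<alpha>] (mod p) \<Longrightarrow> [y = \<beta>] (mod p) \<Longrightarrow>
      p ^ n dvd eval_xy f x y \<Longrightarrow> p ^ n dvd y - poly \<phi> x"
    using newton_approximation[OF p ns, of "n - 1"] n1 by auto
  define I where "I = {..M} \<times> {..e}"
  \<comment> \<open>Composition with the shift by \<alpha> makes \<open>coeff (Q ij) k\<close> the
    k-th Taylor coefficient at \<alpha> of the monomial \<open>ij\<close> on the curve
    \<open>y = \<phi>(x)\<close>.\<close>
  define Q where "Q = (\<lambda>ij. pcompose (monom 1 (fst ij) * \<phi> ^ snd ij) [:\<alpha>, 1:])"
  have p1: "p \<ge> 1" using p prime_ge_1_int by blast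
  have "finite I" "n = card I" by (simp_all add: I_def n_def card_cartesian_product)
  from small_vector_in_flag_lattice[OF this n1 p1 q, of "\<lambda>k ij. coeff (Q ij) k"]
  obtain w where w: "\<exists>ij\<in>I. w ij \<noteq> 0" "\<forall>ij\<in>I. \<bar>real_of_int (w ij)\<bar> \<le> q ^ (n + 1)"
    "\<forall>k<n. p ^ (n - k) dvd (\<Sum>ij\<in>I. w ij * coeff (Q ij) k)"
    by (elim exE conjE)
  define g where "g = bipoly M e w"
  define G where "G = (\<Sum>ij\<in>I. smult (w ij) (Q ij))"
  obtain ij0 where ij0: "ij0 \<in> I" "w ij0 \<noteq> 0" using w(1) by blast
  have "g \<noteq> 0"
  proof
    assume "g = 0"
    then show False using ij0 coeff_bipoly[of M e w "snd ij0" "fst ij0"] by (auto simp: g_def I_def)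
  qed
  moreover have "coeffs_le g (q ^ (n + 1))"
    using w(2) q(1) unfolding coeffs_le_def g_def by (auto simp: coeff_bipoly I_def)
  moreover have "p ^ n dvd eval_xy g x y"
    if xy: "[x = \<alpha>] (mod p)" "[y = \<beta>] (mod p)" "p ^ n dvd eval_xy f x y" for x y
  proof -
    have "[y = poly \<phi> x] (mod p ^ n)" using \<phi>[OF xy] by (simp add: cong_iff_dvd_diff)
    then have "[eval_xy g x y = eval_xy g x (poly \<phi> x)] (mod p ^ n)"
      by (intro eval_xy_cong cong_refl)
    also have "eval_xy g x (poly \<phi> x) = poly G (x - \<alpha>)"
      by (simp add: g_def eval_xy_bipoly G_def poly_sum Q_def poly_pcompose poly_monom I_def mult_ac)
    also have "[\<dots> = 0] (mod p ^ n)"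
    proof -
      have "p ^ n dvd coeff G k * (x - \<alpha>) ^ k" for k
      proof -
        have *: "p ^ k dvd (x - \<alpha>) ^ k" using xy(1) by (simp add: cong_iff_dvd_diff dvd_power_same)
        show ?thesis
        proof (cases "k < n")
          case True
          then have "p ^ (n - k) dvd coeff G k" using w(3) by (simp add: G_def coeff_sum)
          then have "p ^ (n - k) * p ^ k dvd coeff G k * (x - \<alpha>) ^ k" using * by (rule mult_dvd_mono)
          then show ?thesis using True by (simp add: power_add[symmetric])
        next
          case False
          then have "p ^ n dvd p ^ k" by (intro le_imp_power_dvd) simp
          then show ?thesis using * by (meson dvd_mult dvd_trans)
        qed
      qed
      then show ?thesis unfolding poly_altdef cong_0_iff by (intro dvd_sum)
    qed
    finally show ?thesis by (simp add: cong_0_iff)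
  qed
  ultimately show ?thesis using bideg_le_bipoly[of M e w] unfolding g_def by blast
qed

section \<open>Rational points in a residue class\<close>

definition numer :: "rat \<Rightarrow> int" where "numer x = fst (quotient_of x)"
definition denom :: "rat \<Rightarrow> int" where "denom x = snd (quotient_of x)"

lemma denom_pos [simp]: "denom x > 0"
  by (simp add: denom_def quotient_of_denom_pos')

lemma denom_nonzero [simp]: "denom x \<noteq> 0"
  using denom_pos[of x] by linarith

lemma coprime_numer_denom: "coprime (numer x) (denom x)"
  by (metis denom_def numer_def prod.collapse quotient_of_coprime)

lemma rat_conv_numer_denom: "x = of_int (numer x) / of_int (denom x)"
  by (metis denom_def numer_def prod.collapse quotient_of_div)

lemma rat_height_conv: "rat_height x = max \<bar>numer x\<bar> (denom x)"
  using denom_pos[of x] unfolding rat_height_def denom_def numer_def by (simp add: case_prod_beta)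

lemma rat_height_le_iff:
  "real_of_int (rat_height x) \<le> B \<longleftrightarrow> \<bar>real_of_int (numer x)\<bar> \<le> B \<and> real_of_int (denom x) \<le> B"
  unfolding rat_height_conv by (auto simp: max_def)

lemma rat_eqI: "numer x * denom y = numer y * denom x \<Longrightarrow> x = y"
proof -
  assume "numer x * denom y = numer y * denom x"
  then have "(of_int (numer x * denom y) :: rat) = of_int (numer y * denom x)" by simp
  then have "(of_int (numer x) :: rat) / of_int (denom x) = of_int (numer y) / of_int (denom y)"
    by (simp add: frac_eq_eq)
  then show ?thesis using rat_conv_numer_denom by metis
qed

text \<open>The value of $f$ at $(x, y)$ with denominators cleared for bidegree $(m, e)$.\<close>

definition hom_eval :: "int poly poly \<Rightarrow> nat \<Rightarrow> nat \<Rightarrow> rat \<Rightarrow> rat \<Rightarrow> int" where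
  "hom_eval f m e x y = (\<Sum>ij\<in>{..m} \<times> {..e}. coeff (coeff f (snd ij)) (fst ij)
     * (numer x ^ fst ij * denom x ^ (m - fst ij)) * (numer y ^ snd ij * denom y ^ (e - snd ij)))"

lemma power_homogenize:
  assumes "x = (a :: rat) / b" "b \<noteq> 0" "i \<le> m"
  shows "a ^ i * b ^ (m - i) = b ^ m * x ^ i"
proof -
  have "b ^ m = b ^ i * b ^ (m - i)" using assms(3) by (simp add: power_add[symmetric])
  then show ?thesis using assms(1,2) by (simp add: power_divide)
qed

lemma of_int_hom_eval:
  assumes "bideg_le f m e"
  shows "of_int (hom_eval f m e x y) = of_int (denom x) ^ m * of_int (denom y) ^ e * eval_xy (rat_poly2 f) x y"
proof -
  have "of_int (hom_eval f m e x y) = (\<Sum>ij\<in>{..m} \<times> {..e}. of_int (coeff (coeff f (snd ij)) (fst ij))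
     * (of_int (numer x) ^ fst ij * of_int (denom x) ^ (m - fst ij))
     * (of_int (numer y) ^ snd ij * of_int (denom y) ^ (e - snd ij)) :: rat)"
    by (simp add: hom_eval_def)
  also have "\<dots> = (\<Sum>ij\<in>{..m} \<times> {..e}. of_int (denom x) ^ m * of_int (denom y) ^ e *
      (of_int (coeff (coeff f (snd ij)) (fst ij)) * x ^ fst ij * y ^ snd ij))"
  proof (rule sum.cong)
    fix ij assume "ij \<in> {..m} \<times> {..e}"
    then have *: "fst ij \<le> m" "snd ij \<le> e" by auto
    show "of_int (coeff (coeff f (snd ij)) (fst ij))
     * (of_int (numer x) ^ fst ij * of_int (denom x) ^ (m - fst ij))
     * (of_int (numer y) ^ snd ij * of_int (denom y) ^ (e - snd ij)) = of_int (denom x) ^ m * of_int (denom y) ^ e *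
      (of_int (coeff (coeff f (snd ij)) (fst ij)) * x ^ fst ij * y ^ snd ij)"
      by (subst power_homogenize[OF rat_conv_numer_denom _ *(1)], simp,
          subst power_homogenize[OF rat_conv_numer_denom _ *(2)], simp, simp)
  qed simp
  also have "\<dots> = of_int (denom x) ^ m * of_int (denom y) ^ e * eval_xy (rat_poly2 f) x y"
    using assms by (subst eval_xy_altdef[of _ m e]) (simp_all add: sum_distrib_left coeff_map_poly)
  finally show ?thesis .
qed

lemma hom_eval_eq_0_iff:
  assumes "bideg_le f m e"
  shows "hom_eval f m e x y = 0 \<longleftrightarrow> eval_xy (rat_poly2 f) x y = 0"
proof -
  have "hom_eval f m e x y = 0 \<longleftrightarrow> (of_int (hom_eval f m e x y) :: rat) = 0" by simp
  then show ?thesis unfolding of_int_hom_eval[OF assms] by simp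
qed

lemma hom_eval_cong:
  assumes f: "bideg_le f m e" and x: "[numer x = a * denom x] (mod q)" and y: "[numer y = b * denom y] (mod q)"
  shows "[hom_eval f m e x y = denom x ^ m * denom y ^ e * eval_xy f a b] (mod q)"
proof -
  have "[hom_eval f m e x y = (\<Sum>ij\<in>{..m} \<times> {..e}. coeff (coeff f (snd ij)) (fst ij)
     * ((a * denom x) ^ fst ij * denom x ^ (m - fst ij)) * ((b * denom y) ^ snd ij * denom y ^ (e - snd ij)))] (mod q)"
    unfolding hom_eval_def by (intro cong_sum cong_mult cong_pow x y cong_refl)
  also have "(\<Sum>ij\<in>{..m} \<times> {..e}. coeff (coeff f (snd ij)) (fst ij)
     * ((a * denom x) ^ fst ij * denom x ^ (m - fst ij)) * ((b * denom y) ^ snd ij * denom y ^ (e - snd ij)))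
     = (\<Sum>ij\<in>{..m} \<times> {..e}. denom x ^ m * denom y ^ e * (coeff (coeff f (snd ij)) (fst ij) * a ^ fst ij * b ^ snd ij))"
  proof (rule sum.cong)
    fix ij assume "ij \<in> {..m} \<times> {..e}"
    then have "denom x ^ m = denom x ^ fst ij * denom x ^ (m - fst ij)" "denom y ^ e = denom y ^ snd ij * denom y ^ (e - snd ij)"
      by (auto simp: power_add[symmetric])
    then show "coeff (coeff f (snd ij)) (fst ij)
     * ((a * denom x) ^ fst ij * denom x ^ (m - fst ij)) * ((b * denom y) ^ snd ij * denom y ^ (e - snd ij))
     = denom x ^ m * denom y ^ e * (coeff (coeff f (snd ij)) (fst ij) * a ^ fst ij * b ^ snd ij)"
      by (simp add: power_mult_distrib)
  qed simp
  also have "\<dots> = denom x ^ m * denom y ^ e * eval_xy f a b"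
    by (simp add: eval_xy_altdef[OF f] sum_distrib_left)
  finally show ?thesis .
qed

lemma abs_homogeneous_monomial_le:
  fixes B :: real
  assumes "i \<le> m" "B \<ge> 1" "real_of_int (rat_height x) \<le> B"
  shows "\<bar>real_of_int (numer x ^ i * denom x ^ (m - i))\<bar> \<le> B ^ m"
proof -
  have "\<bar>real_of_int (numer x)\<bar> ^ i * \<bar>real_of_int (denom x)\<bar> ^ (m - i) \<le> B ^ i * B ^ (m - i)"
    using assms abs_of_pos[of "real_of_int (denom x)"] unfolding rat_height_le_iff
    by (intro mult_mono power_mono) simp_all
  also have "\<dots> = B ^ m" using assms(1) by (simp add: power_add[symmetric])
  finally show ?thesis by (simp add: abs_mult power_abs)
qed

lemma abs_hom_eval_le:
  assumes "coeffs_le f H" "H \<ge> 0" "B1 \<ge> 1" "B2 \<ge> 1"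
    and "real_of_int (rat_height x) \<le> B1" "real_of_int (rat_height y) \<le> B2"
  shows "\<bar>real_of_int (hom_eval f m e x y)\<bar> \<le> real ((m + 1) * (e + 1)) * (H * B1 ^ m * B2 ^ e)"
proof -
  have "\<bar>real_of_int (hom_eval f m e x y)\<bar> \<le> (\<Sum>ij\<in>{..m} \<times> {..e}. \<bar>real_of_int (coeff (coeff f (snd ij)) (fst ij)
     * (numer x ^ fst ij * denom x ^ (m - fst ij)) * (numer y ^ snd ij * denom y ^ (e - snd ij)))\<bar>)"
    unfolding hom_eval_def of_int_sum by (rule sum_abs)
  also have "\<dots> \<le> (\<Sum>ij\<in>{..m} \<times> {..e}. H * B1 ^ m * B2 ^ e)"
  proof (rule sum_mono)
    fix ij assume ij: "ij \<in> {..m} \<times> {..e}"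
    show "\<bar>real_of_int (coeff (coeff f (snd ij)) (fst ij)
     * (numer x ^ fst ij * denom x ^ (m - fst ij)) * (numer y ^ snd ij * denom y ^ (e - snd ij)))\<bar> \<le> H * B1 ^ m * B2 ^ e"
      unfolding of_int_mult[of "_ * _" "numer y ^ _ * _"] of_int_mult[of "coeff _ _"] abs_mult[of "_ * _" "real_of_int (numer y ^ _ * _)"]
        abs_mult[of "real_of_int (coeff _ _)"]
      using ij assms by (intro mult_mono abs_homogeneous_monomial_le) (auto simp: coeffs_le_def)
  qed
  also have "\<dots> = real ((m + 1) * (e + 1)) * (H * B1 ^ m * B2 ^ e)"
    by (simp add: card_cartesian_product algebra_simps)
  finally show ?thesis .
qed

lemma residue_exists:
  assumes "coprime q (denom x)"
  obtains a where "[numer x = a * denom x] (mod q)"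
proof -
  obtain u where "[denom x * u = 1] (mod q)"
    using cong_solve_coprime_int[of "denom x" q] assms by (auto simp: coprime_commute)
  then have "[numer x * (denom x * u) = numer x * 1] (mod q)" by (intro cong_mult cong_refl)
  then have "[numer x = (numer x * u) * denom x] (mod q)" by (simp add: cong_sym_eq mult_ac)
  then show ?thesis by (rule that)
qed

text \<open>The hypothesis \<open>big\<close> is the size condition for \<open>g\<close>, which has
  (M + 1) d = n monomials and coefficients up to \<open>q ^ (n + 1)\<close>: multiplied by this
  power of \<open>q\<close> it says that all values stay below q^(2n) = p^n. Since \<open>g\<close>
  is nonzero of degree at most d - 1 in X_2, it cannot be a multiple of \<open>f\<close>.\<close>

lemma class_points:
  fixes f :: "int poly poly" and p :: int and q B1 B2 :: real
  assumes irr: "irreducible (rat_poly2 f)" and d: "degree f = d" "d \<ge> 1" and bi: "bideg_le f m d"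
    and p: "prime p" and ns: "\<not> p dvd eval_xy (pderiv f) \<alpha> \<beta>"
    and q: "q \<ge> 0" "q\<^sup>2 = of_int p" and B: "B1 \<ge> 1" "B2 \<ge> 1"
    and big: "real ((M + 1) * d) * (B1 ^ M * B2 ^ (d - 1)) < q ^ ((M + 1) * d - 1)"
    and S: "\<And>x y. (x, y) \<in> S \<Longrightarrow> eval_xy (rat_poly2 f) x y = 0 \<and> real_of_int (rat_height x) \<le> B1
      \<and> real_of_int (rat_height y) \<le> B2 \<and> \<not> p dvd denom x \<and> \<not> p dvd denom y
      \<and> [numer x = \<alpha> * denom x] (mod p) \<and> [numer y = \<beta> * denom y] (mod p)"
  shows "finite S" "card S \<le> ((2 * d + 1) * (M + m)) * d"
proof -
  define n where "n = (M + 1) * d"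
  have n: "(M + 1) * (d - 1 + 1) = n" "n \<ge> 1" using d(2) by (simp_all add: n_def)
  from auxiliary_polynomial[OF p ns q, of M "d - 1", unfolded n]
  obtain g where g: "g \<noteq> 0" "bideg_le g M (d - 1)" "coeffs_le g (q ^ (n + 1))"
    and gv: "\<And>x y. [x = \<alpha>] (mod p) \<Longrightarrow> [y = \<beta>] (mod p) \<Longrightarrow> p ^ n dvd eval_xy f x y \<Longrightarrow> p ^ n dvd eval_xy g x y"
    by blast
  have van: "eval_xy (rat_poly2 g) x y = 0" if xy: "(x, y) \<in> S" for x y
  proof -
    note Sxy = S[OF xy]
    have cop: "coprime (p ^ n) (denom x)" "coprime (p ^ n) (denom y)"
      using Sxy p by (auto intro!: coprime_power_left_iff[THEN iffD2] prime_imp_coprime)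
    \<comment> \<open>Denominators are units modulo \<open>p ^ n\<close>, so the rational point has
      an integral representative \<open>(X, Y)\<close>, to which the congruence statement about
      \<open>g\<close> applies.\<close>
    obtain X where X: "[numer x = X * denom x] (mod p ^ n)" using residue_exists[OF cop(1)] .
    obtain Y where Y: "[numer y = Y * denom y] (mod p ^ n)" using residue_exists[OF cop(2)] .
    have pn: "p dvd p ^ n" using n(2) by simp
    have "[X * denom x = \<alpha> * denom x] (mod p)"
      using cong_dvd_modulus[OF X pn] Sxy by (meson cong_sym cong_trans)
    then have X': "[X = \<alpha>] (mod p)"
      using Sxy p by (subst (asm) cong_mult_rcancel) (auto simp: coprime_commute prime_imp_coprime)
    have "[Y * denom y = \<beta> * denom y] (mod p)"
      using cong_dvd_modulus[OF Y pn] Sxy by (meson cong_sym cong_trans)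
    then have Y': "[Y = \<beta>] (mod p)"
      using Sxy p by (subst (asm) cong_mult_rcancel) (auto simp: coprime_commute prime_imp_coprime)
    have "hom_eval f m d x y = 0" using Sxy hom_eval_eq_0_iff[OF bi] by blast
    then have "p ^ n dvd denom x ^ m * denom y ^ d * eval_xy f X Y"
      using cong_sym[OF hom_eval_cong[OF bi X Y]] by (simp add: cong_0_iff)
    moreover have "coprime (p ^ n) (denom x ^ m * denom y ^ d)"
      using cop by (simp del: coprime_power_left_iff)
    ultimately have "p ^ n dvd eval_xy f X Y" by (simp add: coprime_dvd_mult_right_iff)
    then have "p ^ n dvd eval_xy g X Y" using gv X' Y' by blast
    then have "[denom x ^ M * denom y ^ (d - 1) * eval_xy g X Y = 0] (mod p ^ n)"
      by (simp add: cong_0_iff)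
    then have "p ^ n dvd hom_eval g M (d - 1) x y"
      using hom_eval_cong[OF g(2) X Y] cong_trans cong_0_iff by blast
    moreover have "\<bar>hom_eval g M (d - 1) x y\<bar> < p ^ n"
    proof -
      have "\<bar>real_of_int (hom_eval g M (d - 1) x y)\<bar> \<le> real n * (q ^ (n + 1) * B1 ^ M * B2 ^ (d - 1))"
        using abs_hom_eval_le[OF g(3) _ B, of x y M "d - 1"] Sxy q(1) unfolding n(1) by simp
      also have "\<dots> = q ^ (n + 1) * (real n * (B1 ^ M * B2 ^ (d - 1)))" by (simp add: mult_ac)
      also have "\<dots> < q ^ (n + 1) * q ^ (n - 1)"
      proof (intro mult_strict_left_mono)
        show "real n * (B1 ^ M * B2 ^ (d - 1)) < q ^ (n - 1)" using big by (simp add: n_def)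
        have "q > 0" using q p prime_gt_0_int[of p] by (cases "q = 0") auto
        then show "0 < q ^ (n + 1)" by simp
      qed
      also have "\<dots> = (q\<^sup>2) ^ n"
      proof -
        have "n + 1 + (n - 1) = 2 * n" using n(2) by simp
        then show ?thesis by (simp only: power_add[symmetric] power_mult[symmetric])
      qed
      also have "\<dots> = real_of_int (p ^ n)" by (simp add: q(2))
      finally show ?thesis by linarith
    qed
    ultimately have "hom_eval g M (d - 1) x y = 0"
      using dvd_imp_le_int[of "hom_eval g M (d - 1) x y" "p ^ n"] by fastforce
    then show ?thesis using hom_eval_eq_0_iff[OF g(2)] by blast
  qed
  have ndvd: "\<not> rat_poly2 f dvd rat_poly2 g"
  proof
    assume "rat_poly2 f dvd rat_poly2 g"
    then have "degree f \<le> degree g" using dvd_imp_degree_le[of "rat_poly2 f" "rat_poly2 g"] g(1) by simp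
    then show False using g(2) d unfolding bideg_le_def by linarith
  qed
  have "bideg_le f (M + m) d" "bideg_le g (M + m) d"
    by (rule bideg_le_mono[OF bi]; simp) (rule bideg_le_mono[OF g(2)]; simp)
  from common_zeros[OF irr d this ndvd, of S] show "finite S" "card S \<le> ((2 * d + 1) * (M + m)) * d"
    using S van by blast+
qed

section \<open>Counting with several primes\<close>

text \<open>The first alternative puts the reduction of $x$ at infinity; for $W$ we take the discriminant
  times the leading coefficient, so that the reduction of $x_2$ is finite at the remaining $x_1$.\<close>

definition bad_at :: "int poly \<Rightarrow> int \<Rightarrow> rat \<Rightarrow> bool" where
  "bad_at W p x \<longleftrightarrow> p dvd denom x \<or> (\<exists>\<alpha>. [numer x = \<alpha> * denom x] (mod p) \<and> p dvd poly W \<alpha>)"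

lemma reduced_residue_exists:
  assumes "prime (p :: int)" "\<not> p dvd denom x"
  shows "\<exists>\<alpha>\<in>{0..<p}. [numer x = \<alpha> * denom x] (mod p)"
proof -
  have "coprime p (denom x)" using assms by (simp add: prime_imp_coprime)
  then obtain a where "[numer x = a * denom x] (mod p)" by (rule residue_exists)
  then have "[numer x = (a mod p) * denom x] (mod p)"
    by (meson cong_mod_right cong_mult cong_refl cong_trans cong_sym)
  then show ?thesis using prime_gt_0_int[OF assms(1)] by (intro bexI[of _ "a mod p"]) auto
qed

lemma poly_cong_int: "[a = b] (mod q) \<Longrightarrow> [poly (W :: int poly) a = poly W b] (mod q)"
  unfolding poly_altdef by (intro cong_sum cong_mult cong_pow cong_refl)

text \<open>Where the leading coefficient is prime to \<open>p\<close>, the specialization at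
  \<alpha> stays nonzero modulo \<open>p\<close>, so each fibre has at most \<open>degree f\<close>
  residues.\<close>

lemma card_residue_pairs:
  fixes f :: "int poly poly" and p :: int
  assumes p: "prime p" and A: "\<And>\<alpha>. \<alpha> \<in> A \<Longrightarrow> \<alpha> \<in> {0..<p} \<and> \<not> p dvd poly (lead_coeff f) \<alpha>"
  shows "finite (SIGMA \<alpha>:A. {\<beta> \<in> {0..<p}. p dvd eval_xy f \<alpha> \<beta>})"
    "card (SIGMA \<alpha>:A. {\<beta> \<in> {0..<p}. p dvd eval_xy f \<alpha> \<beta>}) \<le> nat p * degree f"
proof -
  have A': "A \<subseteq> {0..<p}" using A by blast
  have 1: "finite A" using finite_subset[OF A'] by simp
  have 2: "card A \<le> nat p" using card_mono[OF _ A'] by simp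
  have 3: "finite {\<beta> \<in> {0..<p}. p dvd eval_xy f \<alpha> \<beta>} \<and> card {\<beta> \<in> {0..<p}. p dvd eval_xy f \<alpha> \<beta>} \<le> degree f"
    if "\<alpha> \<in> A" for \<alpha>
  proof
    show "finite {\<beta> \<in> {0..<p}. p dvd eval_xy f \<alpha> \<beta>}" by (rule finite_subset[of _ "{0..<p}"]) auto
    define h where "h = map_poly (\<lambda>c. poly c \<alpha>) f"
    have "\<not> p dvd coeff h (degree f)" using A[OF that] by (simp add: h_def coeff_map_poly)
    moreover have "degree h \<le> degree f" unfolding h_def by (rule map_poly_degree_leq)
    ultimately show "card {\<beta> \<in> {0..<p}. p dvd eval_xy f \<alpha> \<beta>} \<le> degree f"
      unfolding eval_xy_conv_section h_def[symmetric] by (intro roots_mod_prime[OF p]) auto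
  qed
  show "finite (SIGMA \<alpha>:A. {\<beta> \<in> {0..<p}. p dvd eval_xy f \<alpha> \<beta>})"
    "card (SIGMA \<alpha>:A. {\<beta> \<in> {0..<p}. p dvd eval_xy f \<alpha> \<beta>}) \<le> nat p * degree f"
    using card_fibration_le[OF 1 2 3 order_refl] by auto
qed

text \<open>If p does not divide R(\<alpha>), the identity \<open>R\<close> shows that the
  derivative is nonzero modulo \<open>p\<close> at every zero of \<open>f\<close> above \<alpha>. So
  every residue pair occurring here satisfies the hypothesis of \<open>class_points\<close>, and
  there are at most \<open>nat p * d\<close> pairs.\<close>

lemma good_points:
  fixes f :: "int poly poly" and p :: int and q B1 B2 :: real
  assumes irr: "irreducible (rat_poly2 f)" and d: "degree f = d" "d \<ge> 1" and bi: "bideg_le f m d"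
    and R: "a * f + b * pderiv f = [:R:]"
    and p: "prime p" and q: "q \<ge> 0" "q\<^sup>2 = of_int p" and B: "B1 \<ge> 1" "B2 \<ge> 1"
    and big: "real ((M + 1) * d) * (B1 ^ M * B2 ^ (d - 1)) < q ^ ((M + 1) * d - 1)"
    and S: "\<And>x y. (x, y) \<in> S \<Longrightarrow> eval_xy (rat_poly2 f) x y = 0 \<and> real_of_int (rat_height x) \<le> B1
      \<and> real_of_int (rat_height y) \<le> B2 \<and> \<not> bad_at (R * lead_coeff f) p x"
  shows "finite S" "card S \<le> nat p * d * (((2 * d + 1) * (M + m)) * d)"
proof -
  define K where "K = ((2 * d + 1) * (M + m)) * d"
  define A where "A = {\<alpha> \<in> {0..<p}. \<not> p dvd poly (R * lead_coeff f) \<alpha>}"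
  define I where "I = (SIGMA \<alpha>:A. {\<beta> \<in> {0..<p}. p dvd eval_xy f \<alpha> \<beta>})"
  define C where "C = (\<lambda>(\<alpha>, \<beta>). {(x, y) \<in> S. \<not> p dvd denom x \<and> \<not> p dvd denom y
      \<and> [numer x = \<alpha> * denom x] (mod p) \<and> [numer y = \<beta> * denom y] (mod p)})"
  have I: "finite I" "card I \<le> nat p * d"
  proof -
    have "\<alpha> \<in> {0..<p} \<and> \<not> p dvd poly (lead_coeff f) \<alpha>" if "\<alpha> \<in> A" for \<alpha>
      using that by (auto simp: A_def)
    from card_residue_pairs[OF p this] show "finite I" "card I \<le> nat p * d"
      unfolding I_def d(1) by auto
  qed
  have C: "finite (C i) \<and> card (C i) \<le> K" if i: "i \<in> I" for i
  proof -
    obtain \<alpha> \<beta> where ab: "i = (\<alpha>, \<beta>)" "\<alpha> \<in> A" "p dvd eval_xy f \<alpha> \<beta>" using i by (auto simp: I_def)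
    have "poly R \<alpha> = eval_xy (a * f + b * pderiv f) \<alpha> \<beta>" unfolding R by simp
    then have "poly R \<alpha> = eval_xy a \<alpha> \<beta> * eval_xy f \<alpha> \<beta> + eval_xy b \<alpha> \<beta> * eval_xy (pderiv f) \<alpha> \<beta>" by simp
    moreover have "\<not> p dvd poly R \<alpha>" using ab(2) by (auto simp: A_def)
    ultimately have ns: "\<not> p dvd eval_xy (pderiv f) \<alpha> \<beta>"
      using ab(3) by (metis dvd_add dvd_mult)
    show ?thesis unfolding K_def
      using class_points[OF irr d bi p ns q B big, of "C i"] S by (auto simp: C_def ab(1))
  qed
  have sub: "S \<subseteq> (\<Union>i\<in>I. C i)"
  proof
    fix z assume z: "z \<in> S"
    obtain x y where xy: "z = (x, y)" by (cases z)
    note Sxy = S[OF z[unfolded xy]]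
    have dx: "\<not> p dvd denom x" using Sxy by (auto simp: bad_at_def)
    obtain \<alpha> where \<alpha>: "\<alpha> \<in> {0..<p}" "[numer x = \<alpha> * denom x] (mod p)"
      using reduced_residue_exists[OF p dx] by blast
    have good: "\<not> p dvd poly (R * lead_coeff f) \<alpha>" using Sxy \<alpha>(2) by (auto simp: bad_at_def)
    have hom0: "hom_eval f m d x y = 0" using Sxy hom_eval_eq_0_iff[OF bi] by blast
    \<comment> \<open>If \<open>p\<close> divided the denominator of \<open>y\<close>, only the
      terms of degree \<open>d\<close> in X_2 would survive modulo \<open>p\<close> in the
      homogenized equation, and the leading coefficient would vanish at \<alpha>.\<close>
    have dy: "\<not> p dvd denom y"
    proof
      assume dy: "p dvd denom y"
      have cny: "\<not> p dvd numer y"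
        using dy p coprime_numer_denom[of y] by (meson coprime_common_divisor not_prime_unit)
      have "[hom_eval f m d x y = (\<Sum>i\<le>m. coeff (coeff f d) i * (numer x ^ i * denom x ^ (m - i)) * numer y ^ d)] (mod p)"
      proof -
        have "hom_eval f m d x y = (\<Sum>j\<le>d. \<Sum>i\<le>m. coeff (coeff f j) i * (numer x ^ i * denom x ^ (m - i))
           * (numer y ^ j * denom y ^ (d - j)))"
          unfolding hom_eval_def by (subst sum.cartesian_product') (simp add: sum.swap[of _ "{..m}"])
        also have "{..d} = insert d {..<d}" by auto
        also have "[(\<Sum>j\<in>insert d {..<d}. \<Sum>i\<le>m. coeff (coeff f j) i * (numer x ^ i * denom x ^ (m - i))
           * (numer y ^ j * denom y ^ (d - j)))
           = (\<Sum>i\<le>m. coeff (coeff f d) i * (numer x ^ i * denom x ^ (m - i)) * numer y ^ d) + 0] (mod p)"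
        proof (subst sum.insert)
          have "p dvd (\<Sum>j<d. \<Sum>i\<le>m. coeff (coeff f j) i * (numer x ^ i * denom x ^ (m - i)) * (numer y ^ j * denom y ^ (d - j)))"
            using dy by (intro dvd_sum dvd_mult) (auto intro: dvd_power_le[of p "denom y" 1, simplified])
          then show "[(\<Sum>i\<le>m. coeff (coeff f d) i * (numer x ^ i * denom x ^ (m - i)) * (numer y ^ d * denom y ^ (d - d)))
             + (\<Sum>j<d. \<Sum>i\<le>m. coeff (coeff f j) i * (numer x ^ i * denom x ^ (m - i)) * (numer y ^ j * denom y ^ (d - j)))
             = (\<Sum>i\<le>m. coeff (coeff f d) i * (numer x ^ i * denom x ^ (m - i)) * numer y ^ d) + 0] (mod p)"
            by (intro cong_add) (simp_all add: cong_0_iff)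
        qed auto
        finally show ?thesis by simp
      qed
      also have "[(\<Sum>i\<le>m. coeff (coeff f d) i * (numer x ^ i * denom x ^ (m - i)) * numer y ^ d)
         = (\<Sum>i\<le>m. coeff (coeff f d) i * ((\<alpha> * denom x) ^ i * denom x ^ (m - i)) * numer y ^ d)] (mod p)"
        by (intro cong_sum cong_mult cong_pow \<alpha>(2) cong_refl)
      also have "(\<Sum>i\<le>m. coeff (coeff f d) i * ((\<alpha> * denom x) ^ i * denom x ^ (m - i)) * numer y ^ d)
         = (\<Sum>i\<le>m. denom x ^ m * numer y ^ d * (coeff (coeff f d) i * \<alpha> ^ i))"
      proof (rule sum.cong)
        fix i assume "i \<in> {..m}"
        then have "denom x ^ m = denom x ^ i * denom x ^ (m - i)" by (simp add: power_add[symmetric])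
        then show "coeff (coeff f d) i * ((\<alpha> * denom x) ^ i * denom x ^ (m - i)) * numer y ^ d
          = denom x ^ m * numer y ^ d * (coeff (coeff f d) i * \<alpha> ^ i)"
          by (simp add: power_mult_distrib)
      qed simp
      also have "\<dots> = denom x ^ m * numer y ^ d * poly (coeff f d) \<alpha>"
      proof -
        have "poly (coeff f d) \<alpha> = (\<Sum>i\<le>m. coeff (coeff f d) i * \<alpha> ^ i)"
          unfolding poly_altdef using bi by (intro sum.mono_neutral_left) (auto simp: bideg_le_def coeff_eq_0)
        then show ?thesis by (simp add: sum_distrib_left)
      qed
      finally have "[0 = denom x ^ m * numer y ^ d * poly (coeff f d) \<alpha>] (mod p)"
        unfolding hom0 .
      then have "p dvd denom x ^ m * numer y ^ d * poly (coeff f d) \<alpha>" by (metis cong_0_iff cong_sym)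
      then show False using p dx cny good d(1)
        by (auto simp: prime_dvd_mult_iff dest: prime_dvd_power)
    qed
    obtain \<beta> where \<beta>: "\<beta> \<in> {0..<p}" "[numer y = \<beta> * denom y] (mod p)"
      using reduced_residue_exists[OF p dy] by blast
    have "p dvd denom x ^ m * denom y ^ d * eval_xy f \<alpha> \<beta>"
      using cong_sym[OF hom_eval_cong[OF bi \<alpha>(2) \<beta>(2)]] hom0 by (simp add: cong_0_iff)
    then have "p dvd eval_xy f \<alpha> \<beta>"
      using p dx dy by (auto simp: prime_dvd_mult_iff dest: prime_dvd_power)
    then have "(\<alpha>, \<beta>) \<in> I" using \<alpha>(1) \<beta>(1) good by (simp add: I_def A_def)
    moreover have "z \<in> C (\<alpha>, \<beta>)" using z dx dy \<alpha>(2) \<beta>(2) by (simp add: C_def xy)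
    ultimately show "z \<in> (\<Union>i\<in>I. C i)" by blast
  qed
  have fin: "finite (\<Union>i\<in>I. C i)" using I C by blast
  then show "finite S" by (rule finite_subset[OF sub])
  have "card S \<le> card (\<Union>i\<in>I. C i)" by (rule card_mono[OF fin sub])
  also have "\<dots> \<le> (\<Sum>i\<in>I. card (C i))" by (rule card_UN_le[OF I(1)])
  also have "\<dots> \<le> (\<Sum>i\<in>I. K)" using C by (intro sum_mono) blast
  also have "\<dots> \<le> nat p * d * K" using I(2) by simp
  finally show "card S \<le> nat p * d * (((2 * d + 1) * (M + m)) * d)" by (simp add: K_def)
qed

text \<open>At each prime \<open>x\<close> is confined to \<open>D\<close> roots of \<open>W\<close>
  and the point at infinity. Two elements in the same class at all primes have a cross difference
  \<open>numer x * denom y - numer y * denom x\<close> divisible by the product of the primes, yet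
  of size at most \<open>2 * B\<^sup>2\<close>.\<close>

lemma everywhere_bad:
  fixes P :: "nat set" and W :: "int poly" and B :: real
  assumes P: "finite P" "\<And>p. p \<in> P \<Longrightarrow> prime p \<and> (\<exists>i. \<not> int p dvd coeff W i)"
    and W: "degree W \<le> D" and big: "2 * B\<^sup>2 < real (\<Prod>P)"
    and T: "\<And>x. x \<in> T \<Longrightarrow> real_of_int (rat_height x) \<le> B \<and> (\<forall>p\<in>P. bad_at W (int p) x)"
  shows "finite T" "card T \<le> (D + 1) ^ card P"
proof -
  \<comment> \<open>The point at infinity is encoded by the value \<open>p\<close>, which no residue
    in {0..<p} takes.\<close>
  define cls where "cls = (\<lambda>x p. if int p dvd denom x then int p
    else (SOME \<alpha>. \<alpha> \<in> {0..<int p} \<and> [numer x = \<alpha> * denom x] (mod int p)))"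
  define C where "C = (\<lambda>p. insert (int p) {\<alpha> \<in> {0..<int p}. int p dvd poly W \<alpha>})"
  have cls: "cls x p \<in> {0..<int p} \<and> [numer x = cls x p * denom x] (mod int p)"
    if "p \<in> P" "\<not> int p dvd denom x" for p x
    using someI_ex[OF reduced_residue_exists[of "int p" x, unfolded Bex_def]] P(2)[OF that(1)] that(2)
    by (simp add: cls_def)
  have cls_inf: "cls x p = int p \<longleftrightarrow> int p dvd denom x" if "p \<in> P" for p x
    using cls[OF that, of x] by (cases "int p dvd denom x") (auto simp: cls_def)
  have C: "finite (C p) \<and> card (C p) \<le> D + 1" if "p \<in> P" for p
  proof -
    have fin: "finite {\<alpha> \<in> {0..<int p}. int p dvd poly W \<alpha>}" by (rule finite_subset[of _ "{0..<int p}"]) auto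
    have "card {\<alpha> \<in> {0..<int p}. int p dvd poly W \<alpha>} \<le> D"
      using P(2)[OF that] W by (intro roots_mod_prime) auto
    then show ?thesis using fin unfolding C_def by (simp add: card_insert_if)
  qed
  have cls_C: "cls x p \<in> C p" if xT: "x \<in> T" and pP: "p \<in> P" for x p
  proof (cases "int p dvd denom x")
    case True
    then show ?thesis using cls_inf[OF pP] by (simp add: C_def)
  next
    case False
    then obtain \<alpha> where \<alpha>: "[numer x = \<alpha> * denom x] (mod int p)" "int p dvd poly W \<alpha>"
      using T[OF xT] pP by (auto simp: bad_at_def)
    note c = cls[OF pP False]
    have "[\<alpha> * denom x = cls x p * denom x] (mod int p)" using \<alpha>(1) c by (meson cong_sym cong_trans)
    moreover have "coprime (denom x) (int p)"
      using P(2)[OF pP] False by (metis coprime_commute prime_imp_coprime prime_nat_int_transfer)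
    ultimately have "[\<alpha> = cls x p] (mod int p)" by (simp add: cong_mult_rcancel)
    then have "[poly W \<alpha> = poly W (cls x p)] (mod int p)" by (rule poly_cong_int)
    then have "int p dvd poly W (cls x p)" using \<alpha>(2) by (simp add: cong_dvd_iff)
    then show ?thesis using c by (simp add: C_def)
  qed
  define \<Phi> where "\<Phi> = (\<lambda>x. \<lambda>p\<in>P. cls x p)"
  have sub: "\<Phi> ` T \<subseteq> (\<Pi>\<^sub>E p\<in>P. C p)" using cls_C by (auto simp: \<Phi>_def)
  have fin: "finite (\<Pi>\<^sub>E p\<in>P. C p)" using P(1) C by (intro finite_PiE) auto
  have inj: "inj_on \<Phi> T"
  proof
    fix x y assume xy: "x \<in> T" "y \<in> T" "\<Phi> x = \<Phi> y"
    define z where "z = numer x * denom y - numer y * denom x"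
    have "int p dvd z" if "p \<in> P" for p
    proof -
      have eq: "cls x p = cls y p" using fun_cong[OF xy(3), of p] that by (simp add: \<Phi>_def)
      show ?thesis
      proof (cases "int p dvd denom x")
        case True
        then have "int p dvd denom y" using eq cls_inf[OF that] by metis
        then show ?thesis using True by (simp add: z_def)
      next
        case False
        then have "\<not> int p dvd denom y" using eq cls_inf[OF that] by metis
        then have "[numer x = cls x p * denom x] (mod int p)" "[numer y = cls x p * denom y] (mod int p)"
          using cls[OF that] False eq by metis+
        then have "[z = cls x p * denom x * denom y - cls x p * denom y * denom x] (mod int p)"
          unfolding z_def by (intro cong_diff cong_mult cong_refl)
        then show ?thesis by (simp add: mult_ac cong_0_iff)
      qed
    qed
    then have dv: "p dvd nat \<bar>z\<bar>" if "p \<in> P" for p using that by (simp add: int_dvd_int_iff[symmetric])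
    have "z = 0"
    proof (rule ccontr)
      assume "z \<noteq> 0"
      then have "\<Prod>P \<le> nat \<bar>z\<bar>" using P dv by (intro prod_primes_le) auto
      then have "real (\<Prod>P) \<le> real_of_int \<bar>z\<bar>" by linarith
      also have "\<dots> \<le> \<bar>real_of_int (numer x)\<bar> * \<bar>real_of_int (denom y)\<bar> + \<bar>real_of_int (numer y)\<bar> * \<bar>real_of_int (denom x)\<bar>"
        unfolding z_def of_int_abs of_int_diff of_int_mult abs_mult[symmetric] by (rule abs_triangle_ineq4)
      also have "\<dots> \<le> B * B + B * B"
        using T[OF xy(1)] T[OF xy(2)] denom_pos[of x] denom_pos[of y] unfolding rat_height_le_iff
        by (intro add_mono mult_mono) (auto simp: less_imp_le)
      finally show False using big by (simp add: power2_eq_square)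
    qed
    then show "x = y" by (intro rat_eqI) (simp add: z_def)
  qed
  show "finite T" using inj_on_finite[OF inj sub fin] .
  have "card T \<le> card (\<Pi>\<^sub>E p\<in>P. C p)" by (rule card_inj_on_le[OF inj sub fin])
  also have "\<dots> = (\<Prod>p\<in>P. card (C p))" using P(1) by (rule card_PiE)
  also have "\<dots> \<le> (\<Prod>p\<in>P. D + 1)" using C by (intro prod_mono) auto
  finally show "card T \<le> (D + 1) ^ card P" by simp
qed

text \<open>The first summand counts, prime by prime, the points whose \<open>x\<close> is good
  there; the second counts the points with \<open>x\<close> bad at all primes, at most
  \<open>d\<close> above each such \<open>x\<close>.\<close>

lemma counting_with_primes:
  fixes f :: "int poly poly" and B1 B2 :: real
  assumes irr: "irreducible (rat_poly2 f)" and d: "degree f = d" "d \<ge> 1" and bi: "bideg_le f m d"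
    and R: "a * f + b * pderiv f = [:R:]" "degree (R * lead_coeff f) \<le> D"
    and P: "finite P" "\<And>p. p \<in> P \<Longrightarrow> prime p \<and> p \<le> N \<and> (\<exists>i. \<not> int p dvd coeff (R * lead_coeff f) i)"
    and B: "B1 \<ge> 1" "B2 \<ge> 1"
    and big: "\<And>p. p \<in> P \<Longrightarrow> real ((M + 1) * d) * (B1 ^ M * B2 ^ (d - 1)) < sqrt (real p) ^ ((M + 1) * d - 1)"
    and prod: "2 * B1\<^sup>2 < real (\<Prod>P)"
    and S: "\<And>x y. (x, y) \<in> S \<Longrightarrow> eval_xy (rat_poly2 f) x y = 0 \<and> real_of_int (rat_height x) \<le> B1
      \<and> real_of_int (rat_height y) \<le> B2"
  shows "card S \<le> card P * (N * d * (((2 * d + 1) * (M + m)) * d)) + (D + 1) ^ card P * d"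
proof -
  define K where "K = ((2 * d + 1) * (M + m)) * d"
  define W where "W = R * lead_coeff f"
  define G where "G = (\<lambda>p. {(x, y) \<in> S. \<not> bad_at W (int p) x})"
  define E where "E = {(x, y) \<in> S. \<forall>p\<in>P. bad_at W (int p) x}"
  have G: "finite (G p) \<and> card (G p) \<le> N * d * K" if "p \<in> P" for p
  proof -
    have "prime (int p)" using P(2)[OF that] by simp
    moreover have "(sqrt (real p))\<^sup>2 = of_int (int p)" by simp
    ultimately have "finite (G p) \<and> card (G p) \<le> nat (int p) * d * K"
      unfolding K_def using good_points[OF irr d bi R(1) _ _ _ B big[OF that], of "int p" "G p"] S
      by (auto simp: G_def W_def)
    moreover have "nat (int p) * d * K \<le> N * d * K" using P(2)[OF that] by simp
    ultimately show ?thesis by linarith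
  qed
  have PW: "prime p \<and> (\<exists>i. \<not> int p dvd coeff W i)" if "p \<in> P" for p
    using P(2)[OF that] by (simp add: W_def)
  have EW: "real_of_int (rat_height x) \<le> B1 \<and> (\<forall>p\<in>P. bad_at W (int p) x)" if "x \<in> fst ` E" for x
    using that S by (auto simp: E_def)
  have T: "finite (fst ` E)" "card (fst ` E) \<le> (D + 1) ^ card P"
    using everywhere_bad[OF P(1) PW R(2)[folded W_def] prod EW] by auto
  have sec: "finite {y. eval_xy (rat_poly2 f) x y = 0} \<and> card {y. eval_xy (rat_poly2 f) x y = 0} \<le> d" for x
    using card_section_le[OF irr, of x] d by simp
  have "E \<subseteq> (SIGMA x:fst ` E. {y. eval_xy (rat_poly2 f) x y = 0})" using S by (force simp: E_def)
  then have E: "finite E" "card E \<le> (D + 1) ^ card P * d"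
    using card_fibration_le[OF T, of "\<lambda>x. {y. eval_xy (rat_poly2 f) x y = 0}" d E] sec by blast+
  have sub: "S \<subseteq> (\<Union>p\<in>P. G p) \<union> E" by (auto simp: G_def E_def)
  have fin: "finite (\<Union>p\<in>P. G p)" using P(1) G by blast
  have "card S \<le> card ((\<Union>p\<in>P. G p) \<union> E)" using fin E(1) by (intro card_mono[OF _ sub]) auto
  also have "\<dots> \<le> card (\<Union>p\<in>P. G p) + card E" by (rule card_Un_le)
  also have "card (\<Union>p\<in>P. G p) \<le> (\<Sum>p\<in>P. card (G p))" by (rule card_UN_le[OF P(1)])
  also have "\<dots> \<le> (\<Sum>p\<in>P. N * d * K)" using G by (intro sum_mono) blast
  finally show ?thesis using E(2) by (simp add: K_def)
qed

section \<open>Bounding the coefficients of the equation\<close>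

text \<open>Vanishing at the points of \<open>S\<close> is a linear system for the coefficients,
  with entries bounded by \<open>B1 ^ d1 * B2 ^ d2\<close>. It is solved by \<open>f\<close>, hence
  also by a polynomial \<open>g\<close> of small height. Either \<open>f\<close> and
  \<open>g\<close> share few zeros, or \<open>f\<close> divides \<open>g\<close> and comparing
  degrees in both variables makes the quotient a constant.\<close>

lemma small_height_equation:
  fixes f :: "int poly poly" and B1 B2 :: real
  assumes irr: "irreducible (rat_poly2 f)" and d: "degree f = d2" "d2 \<ge> 1" and bi: "bideg_le f d1 d2"
    and d1: "degree (coeff f j1) = d1" "coeff f j1 \<noteq> 0"
    and B: "B1 \<ge> 1" "B2 \<ge> 1"
    and S: "\<And>x y. (x, y) \<in> S \<Longrightarrow> eval_xy (rat_poly2 f) x y = 0 \<and> real_of_int (rat_height x) \<le> B1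
      \<and> real_of_int (rat_height y) \<le> B2"
  shows "card S \<le> ((2 * d2 + 1) * d1) * d2 \<or>
    (\<exists>g. irreducible (rat_poly2 g) \<and> degree g = d2 \<and> bideg_le g d1 d2
       \<and> coeffs_le g (kernel_bound ((d1 + 1) * (d2 + 1)) (B1 ^ d1 * B2 ^ d2))
       \<and> (\<forall>(x, y)\<in>S. eval_xy (rat_poly2 g) x y = 0))"
proof -
  define J where "J = {..d1} \<times> {..d2}"
  define r where "r = (\<lambda>(x, y) ij. (numer x ^ fst ij * denom x ^ (d1 - fst ij)) * (numer y ^ snd ij * denom y ^ (d2 - snd ij)))"
  have hom: "hom_eval h d1 d2 x y = (\<Sum>ij\<in>J. r (x, y) ij * coeff (coeff h (snd ij)) (fst ij))" for h x y
    by (simp add: hom_eval_def J_def r_def mult_ac)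
  define H where "H = B1 ^ d1 * B2 ^ d2"
  have H: "H \<ge> 1" using B mult_mono[of 1 "B1 ^ d1" 1 "B2 ^ d2"] by (simp add: H_def)
  have f0: "f \<noteq> 0" using irr by auto
  have ex: "\<exists>v. (\<exists>ij\<in>J. v ij \<noteq> 0) \<and> (\<forall>z\<in>S. (\<Sum>ij\<in>J. r z ij * v ij) = 0)"
  proof (intro exI[of _ "\<lambda>ij. coeff (coeff f (snd ij)) (fst ij)"] conjI ballI)
    have "lead_coeff (coeff f j1) \<noteq> 0" using d1(2) by simp
    moreover have "j1 \<le> d2" using d1(2) d(1) le_degree by blast
    ultimately show "\<exists>ij\<in>J. coeff (coeff f (snd ij)) (fst ij) \<noteq> 0"
      using d1(1) by (intro bexI[of _ "(d1, j1)"]) (auto simp: J_def)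
    fix z assume "z \<in> S"
    then show "(\<Sum>ij\<in>J. r z ij * coeff (coeff f (snd ij)) (fst ij)) = 0"
      using S[of "fst z" "snd z"] hom[of f "fst z" "snd z"] hom_eval_eq_0_iff[OF bi] by (metis prod.collapse)
  qed
  have rb: "\<bar>real_of_int (r z ij)\<bar> \<le> H" if z: "z \<in> S" and ij: "ij \<in> J" for z ij
  proof -
    obtain x y where xy: "z = (x, y)" by (cases z)
    have "\<bar>real_of_int (numer x ^ fst ij * denom x ^ (d1 - fst ij))\<bar> * \<bar>real_of_int (numer y ^ snd ij * denom y ^ (d2 - snd ij))\<bar>
        \<le> B1 ^ d1 * B2 ^ d2"
      using z ij S[of x y] B unfolding xy
      by (intro mult_mono abs_homogeneous_monomial_le) (auto simp: J_def)
    then show ?thesis unfolding r_def xy H_def by (simp add: abs_mult)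
  qed
  have "finite J" by (simp add: J_def)
  then have "\<exists>w. (\<exists>ij\<in>J. w ij \<noteq> 0) \<and> (\<forall>ij\<in>J. \<bar>real_of_int (w ij)\<bar> \<le> kernel_bound (card J) H)
      \<and> (\<forall>z\<in>S. (\<Sum>ij\<in>J. r z ij * w ij) = 0)"
    by (rule small_kernel[OF _ H _ ex]) (rule rb)
  then obtain w where w: "\<exists>ij\<in>J. w ij \<noteq> 0" "\<forall>ij\<in>J. \<bar>real_of_int (w ij)\<bar> \<le> kernel_bound (card J) H"
    "\<forall>z\<in>S. (\<Sum>ij\<in>J. r z ij * w ij) = 0" by (elim exE conjE)
  have cJ: "card J = (d1 + 1) * (d2 + 1)" by (simp add: J_def card_cartesian_product)
  define g where "g = bipoly d1 d2 w"
  have big: "bideg_le g d1 d2" by (simp add: g_def bideg_le_bipoly)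
  obtain ij0 where ij0: "ij0 \<in> J" "w ij0 \<noteq> 0" using w(1) by blast
  have g0: "g \<noteq> 0"
  proof
    assume "g = 0"
    then show False using ij0 coeff_bipoly[of d1 d2 w "snd ij0" "fst ij0"] by (auto simp: g_def J_def)
  qed
  have cg: "coeffs_le g (kernel_bound (card J) H)"
    using w(2) kernel_bound_ge_1[OF H, of "card J"] unfolding coeffs_le_def g_def
    by (auto simp: coeff_bipoly J_def)
  have gz: "eval_xy (rat_poly2 g) x y = 0" if "(x, y) \<in> S" for x y
  proof -
    have "hom_eval g d1 d2 x y = (\<Sum>ij\<in>J. r (x, y) ij * w ij)"
      unfolding hom by (intro sum.cong) (auto simp: g_def coeff_bipoly J_def)
    then show ?thesis using w(3) that hom_eval_eq_0_iff[OF big] by force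
  qed
  show ?thesis
  proof (cases "rat_poly2 f dvd rat_poly2 g")
    case False
    then show ?thesis using common_zeros(2)[OF irr d bi big False, of S] S gz by blast
  next
    case True
    then obtain h where h: "rat_poly2 g = rat_poly2 f * h" by (elim dvdE)
    have h0: "h \<noteq> 0" using g0 h by auto
    have "degree (rat_poly2 g) = degree (rat_poly2 f) + degree h"
      unfolding h using f0 h0 by (intro degree_mult_eq) auto
    then have "degree h = 0" and dg: "degree g = d2" using big d by (auto simp: bideg_le_def)
    then obtain c where c: "h = [:c:]" using degree_eq_zeroE by blast
    have c0: "c \<noteq> 0" using h0 c by simp
    \<comment> \<open>The coefficient at \<open>j1\<close> has the full degree \<open>d1\<close> in
      X_1, which leaves no room for X_1 in the quotient \<open>c\<close>.\<close>
    have "rat_poly (coeff g j1) = rat_poly (coeff f j1) * c"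
      using arg_cong[OF h, of "\<lambda>u. coeff u j1"] by (simp add: c coeff_map_poly mult.commute)
    then have "degree (rat_poly (coeff g j1)) = degree (rat_poly (coeff f j1)) + degree c"
      using d1(2) c0 by (simp only:) (intro degree_mult_eq, auto)
    then have "degree c = 0" using big d1(1) by (simp add: bideg_le_def) (metis add_le_same_cancel1 le_0_eq)
    then obtain k where k: "c = [:k:]" using degree_eq_zeroE by blast
    have "is_unit h" using c0 by (simp add: c k is_unit_const_poly_iff is_unit_pCons_iff dvd_field_iff)
    then have "irreducible (rat_poly2 g)" unfolding h using irr by (simp add: mult.commute[of _ h] irreducible_mult_unit_left)
    then show ?thesis using dg big cg gz unfolding cJ H_def by blast
  qed
qed

text \<open>Any nonzero combination of \<open>f\<close> and its derivative free of X_2 can stand in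
  for the discriminant. Bounding a single coefficient is enough: a prime not dividing it leaves the
  polynomial nonzero modulo that prime.\<close>

lemma discriminant_exists:
  fixes d1 d2 :: nat
  assumes d2: "d2 \<ge> 1"
  shows "\<exists>A\<ge>1. \<exists>k. \<forall>f H. irreducible (rat_poly2 f) \<and> degree f = d2 \<and> bideg_le f d1 d2 \<and> coeffs_le f H \<and> H \<ge> 1
     \<longrightarrow> (\<exists>a b R. a * f + b * pderiv f = [:R:] \<and> degree (R * lead_coeff f) \<le> (2 * d2 + 2) * d1
           \<and> R * lead_coeff f \<noteq> 0 \<and> \<bar>real_of_int (lead_coeff (R * lead_coeff f))\<bar> \<le> A * H ^ k)"
proof -
  define n where "n = 2 * (d2 * (2 * d2 * d1 + 1))"
  obtain A k where A: "A \<ge> 1" "\<And>H. H \<ge> 1 \<Longrightarrow> kernel_bound n H \<le> A * H ^ k"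
    using kernel_bound_polynomial[of n] by blast
  define A' where "A' = real n * (real d2 * (A * real d2 ^ k))"
  have n1: "n \<ge> 1" using d2 by (simp add: n_def)
  have "A' \<ge> 1"
  proof -
    have "real d2 ^ k \<ge> 1" using d2 by simp
    then have "1 * 1 \<le> A * real d2 ^ k" using A(1) by (intro mult_mono) auto
    then have "1 * (1 * 1) \<le> A'" unfolding A'_def using d2 n1 by (intro mult_mono) auto
    then show ?thesis by simp
  qed
  moreover have "\<exists>a b R. a * f + b * pderiv f = [:R:] \<and> degree (R * lead_coeff f) \<le> (2 * d2 + 2) * d1
           \<and> R * lead_coeff f \<noteq> 0 \<and> \<bar>real_of_int (lead_coeff (R * lead_coeff f))\<bar> \<le> A' * H ^ (k + 2)"
    if f: "irreducible (rat_poly2 f)" "degree f = d2" "bideg_le f d1 d2" "coeffs_le f H" "H \<ge> 1" for f H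
  proof -
    \<comment> \<open>The factor \<open>d2\<close> covers the coefficients of the derivative as
      well.\<close>
    define H' where "H' = real d2 * H"
    have H': "H' \<ge> 1" "H' \<ge> H" using f(5) d2 mult_mono[of 1 "real d2" 1 H] mult_right_mono[of 1 "real d2" H]
      by (auto simp: H'_def)
    have cf: "coeffs_le f H'" using f(4) H'(2) by (rule coeffs_le_mono)
    have cf': "coeffs_le (pderiv f) H'"
      unfolding coeffs_le_def
    proof (intro allI)
      fix i j
      have eq: "coeff (coeff (pderiv f) j) i = int (Suc j) * coeff (coeff f (Suc j)) i"
      proof -
        have "(of_nat (Suc j) :: int poly) = [:int (Suc j):]" by (simp only: of_nat_poly)
        then show ?thesis by (simp only: coeff_pderiv) simp
      qed
      show "\<bar>real_of_int (coeff (coeff (pderiv f) j) i)\<bar> \<le> H'"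
      proof (cases "Suc j \<le> d2")
        case True
        have "\<bar>real_of_int (coeff (coeff (pderiv f) j) i)\<bar> = real (Suc j) * \<bar>real_of_int (coeff (coeff f (Suc j)) i)\<bar>"
          unfolding eq by (simp add: abs_mult)
        also have "\<dots> \<le> real d2 * H" using True f(4) f(5) by (intro mult_mono) (auto simp: coeffs_le_def)
        finally show ?thesis by (simp add: H'_def)
      next
        case False
        then have "coeff f (Suc j) = 0" using f(2) by (intro coeff_eq_0) simp
        then show ?thesis unfolding eq using H'(1) by simp
      qed
    qed
    have bf': "bideg_le (pderiv f) d1 d2"
      unfolding bideg_le_def
    proof (intro conjI allI)
      show "degree (pderiv f) \<le> d2" using f(2) by (simp add: degree_pderiv)
      fix j
      have "degree (of_nat (Suc j) * coeff f (Suc j)) \<le> degree (of_nat (Suc j) :: int poly) + degree (coeff f (Suc j))"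
        by (rule degree_mult_le)
      then show "degree (coeff (pderiv f) j) \<le> d1"
        using f(3) unfolding coeff_pderiv bideg_le_def by (metis add_0 degree_of_nat order_trans)
    qed
    have nd: "\<not> rat_poly2 f dvd rat_poly2 (pderiv f)"
      unfolding rat_poly2_pderiv using f(2) d2 by (intro not_dvd_pderiv) simp
    from elimination[OF f(1,2) d2 f(3) bf' nd cf cf' H'(1)]
    obtain a b R where R: "a * f + b * pderiv f = [:R:]" "R \<noteq> 0" "degree R \<le> (2 * d2 + 1) * d1"
      "\<forall>i. \<bar>real_of_int (coeff R i)\<bar> \<le> real n * (H' * kernel_bound n H')"
      unfolding n_def by (elim exE conjE)
    have f0: "f \<noteq> 0" using f(2) d2 by auto
    have l0: "lead_coeff f \<noteq> 0" using f0 by simp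
    have "degree (R * lead_coeff f) \<le> degree R + degree (lead_coeff f)" by (rule degree_mult_le)
    also have "\<dots> \<le> (2 * d2 + 1) * d1 + d1" using R(3) f(3) by (intro add_mono) (auto simp: bideg_le_def)
    finally have deg: "degree (R * lead_coeff f) \<le> (2 * d2 + 2) * d1" by (simp add: algebra_simps)
    have "\<bar>real_of_int (lead_coeff (R * lead_coeff f))\<bar> = \<bar>real_of_int (lead_coeff R)\<bar> * \<bar>real_of_int (lead_coeff (lead_coeff f))\<bar>"
      by (simp add: lead_coeff_mult abs_mult)
    also have "\<dots> \<le> (real n * (H' * kernel_bound n H')) * H"
      using R(4) f(4,5) H'(1) kernel_bound_ge_1[OF H'(1), of n] by (intro mult_mono) (auto simp: coeffs_le_def)
    also have "\<dots> \<le> (real n * (H' * (A * H' ^ k))) * H"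
      using A(2)[OF H'(1)] H'(1) f(5) by (intro mult_right_mono mult_left_mono) auto
    also have "\<dots> = A' * H ^ (k + 2)"
      by (simp add: A'_def H'_def power_mult_distrib power2_eq_square power_add mult_ac)
    finally show ?thesis using R(1,2) deg l0 by (intro exI[of _ a] exI[of _ b] exI[of _ R]) auto
  qed
  ultimately show ?thesis by (intro exI[of _ A'] conjI exI[of _ "k + 2"]) auto
qed

section \<open>Trivial bounds: rationals of bounded height and horizontal fibres\<close>

lemma card_rat_height_le:
  assumes "B \<ge> 1"
  shows "finite {x. real_of_int (rat_height x) \<le> B}" "real (card {x. real_of_int (rat_height x) \<le> B}) \<le> 3 * B\<^sup>2"
proof -
  define I where "I = {- \<lfloor>B\<rfloor>..\<lfloor>B\<rfloor>} \<times> {1..\<lfloor>B\<rfloor>}"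
  have inj: "inj_on (\<lambda>x. (numer x, denom x)) {x. real_of_int (rat_height x) \<le> B}"
    by (intro inj_onI rat_eqI) auto
  have sub: "(\<lambda>x. (numer x, denom x)) ` {x. real_of_int (rat_height x) \<le> B} \<subseteq> I"
  proof (rule image_subsetI)
    fix x assume "x \<in> {x. real_of_int (rat_height x) \<le> B}"
    then have "\<bar>real_of_int (numer x)\<bar> \<le> B" "real_of_int (denom x) \<le> B" by (auto simp: rat_height_le_iff)
    then have "numer x \<le> \<lfloor>B\<rfloor>" "- numer x \<le> \<lfloor>B\<rfloor>" "denom x \<le> \<lfloor>B\<rfloor>" by (auto simp: le_floor_iff)
    moreover have "denom x \<ge> 1" using denom_pos[of x] by linarith
    ultimately show "(numer x, denom x) \<in> I" by (auto simp: I_def)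
  qed
  have fin: "finite I" by (simp add: I_def)
  show "finite {x. real_of_int (rat_height x) \<le> B}" using inj_on_finite[OF inj sub fin] .
  have "card {x. real_of_int (rat_height x) \<le> B} \<le> card I" by (rule card_inj_on_le[OF inj sub fin])
  also have "card I = nat (2 * \<lfloor>B\<rfloor> + 1) * nat \<lfloor>B\<rfloor>" by (simp add: I_def card_cartesian_product)
  finally have "real (card {x. real_of_int (rat_height x) \<le> B}) \<le> real (nat (2 * \<lfloor>B\<rfloor> + 1) * nat \<lfloor>B\<rfloor>)"
    unfolding of_nat_le_iff .
  also have "\<dots> = (2 * of_int \<lfloor>B\<rfloor> + 1) * of_int \<lfloor>B\<rfloor>" using assms by simp
  also have "\<dots> \<le> (3 * B) * B"
  proof (intro mult_mono)
    show "2 * of_int \<lfloor>B\<rfloor> + 1 \<le> 3 * B" "of_int \<lfloor>B\<rfloor> \<le> B" using assms by linarith+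
    show "0 \<le> real_of_int \<lfloor>B\<rfloor>" "0 \<le> 3 * B" using assms by simp_all
  qed
  finally show "real (card {x. real_of_int (rat_height x) \<le> B}) \<le> 3 * B\<^sup>2" by (simp add: power2_eq_square)
qed

text \<open>A horizontal line in the curve would be a factor X_2 - y, which irreducibility permits
  only if \<open>F\<close> is that line up to a unit; degree at least 2 excludes this.\<close>

lemma card_cosection_le:
  assumes irr: "irreducible F" and deg: "degree F \<ge> 2" and bi: "bideg_le F m e"
  shows "finite {x. eval_xy F x (y::rat) = 0}" "card {x. eval_xy F x y = 0} \<le> m"
proof -
  have *: "poly F [:y:] \<noteq> 0"
  proof
    assume "poly F [:y:] = 0"
    then obtain h where h: "F = [:- [:y:], 1:] * h" by (auto simp: poly_eq_0_iff_dvd)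
    moreover have "\<not> is_unit [:- [:y:], 1:]" by (auto simp: is_unit_poly_iff)
    ultimately have "is_unit h" using irr irreducibleD by blast
    then have "degree h = 0" "h \<noteq> 0" by (auto simp: is_unit_poly_iff)
    then have "degree F = 1" unfolding h by (subst degree_mult_eq) auto
    then show False using deg by simp
  qed
  have "degree (coeff F i * [:y:] ^ i) \<le> m" for i
  proof -
    have "[:y:] ^ i = [:y ^ i:]" by (induction i) (auto simp: one_pCons)
    then show ?thesis using bi by (auto simp: bideg_le_def)
  qed
  then have "degree (poly F [:y:]) \<le> m"
    unfolding poly_altdef by (intro degree_sum_le) auto
  moreover have "card {x. poly (poly F [:y:]) x = 0} \<le> degree (poly F [:y:])" by (rule card_poly_roots_bound[OF *])
  ultimately show "card {x. eval_xy F x y = 0} \<le> m" by (simp add: eval_xy_def)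
  show "finite {x. eval_xy F x y = 0}" unfolding eval_xy_def by (rule poly_roots_finite[OF *])
qed

section \<open>Choice of the parameters\<close>

lemma ln2_ge_half: "1 / 2 \<le> ln (2 :: real)"
  using ln_le_minus_one[of "1 / 2 :: real"] by (simp add: ln_div)

text \<open>This provides the hypothesis of \<open>card_primes_not_dvd\<close> for N about C Y L.
  After taking logarithms the terms are Y ln N, sqrt(N) ln N and ln D. As ln N is ln C + O(L), the
  first is O(Y L (1 + ln C)), which a large \<open>C\<close> beats; the second is o(N); the third is
  at most \<open>c1 * L\<close>. The root of N is added to Y because the primes must exceed
  it.\<close>

lemma prime_range_estimate:
  fixes c1 c2 :: real and k :: nat
  shows "\<exists>C\<ge>1. \<forall>Y L D. Y \<ge> 1 \<longrightarrow> L \<ge> 1 / 2 \<longrightarrow> ln Y \<le> c2 * L \<longrightarrow> D \<ge> (1::real) \<longrightarrow> ln D \<le> c1 * L \<longrightarrow>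
     real (nat \<lceil>C * Y * L\<rceil>) ^ (nat (\<lceil>Y\<rceil> + \<lceil>sqrt (real (nat \<lceil>C * Y * L\<rceil>))\<rceil>) + k) * D < 2 ^ (nat \<lceil>C * Y * L\<rceil> - 1)"
proof -
  have ln_small: "\<exists>x0. \<forall>x\<ge>x0. ln x \<le> \<epsilon> * x" if "\<epsilon> > 0" for \<epsilon> :: real
  proof -
    have "\<forall>\<^sub>F x in at_top. ln x / x < \<epsilon>" by (rule order_tendstoD(2)[OF ln_x_over_x_tendsto_0 that])
    then obtain x0 where x0: "\<And>x. x \<ge> x0 \<Longrightarrow> ln x / x < \<epsilon>" by (auto simp: eventually_at_top_linorder)
    have "ln x \<le> \<epsilon> * x" if "x \<ge> max x0 1" for x
      using x0[of x] that by (simp add: field_simps)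
    then show ?thesis by blast
  qed
  have "1 / (16 * (real k + 3)) > 0" by simp
  then obtain n0 where n0: "\<And>x. x \<ge> n0 \<Longrightarrow> ln x \<le> 1 / (16 * (real k + 3)) * x" using ln_small by blast
  define N0 where "N0 = (max n0 1)\<^sup>2"
  have N0: "(real k + 3) * (sqrt x * ln x) \<le> x / 8" if "x \<ge> N0" for x
  proof -
    have "x \<ge> 1" using that one_le_power[of "max n0 1" 2] unfolding N0_def by linarith
    have "sqrt x \<ge> max n0 1" using real_sqrt_le_mono[OF that] by (simp add: N0_def)
    then have "ln (sqrt x) \<le> 1 / (16 * (real k + 3)) * sqrt x" by (intro n0) simp
    then have "ln x \<le> 1 / (8 * (real k + 3)) * sqrt x" using \<open>x \<ge> 1\<close> by (simp add: ln_sqrt field_simps)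
    then have "sqrt x * ln x \<le> sqrt x * (1 / (8 * (real k + 3)) * sqrt x)"
      using \<open>x \<ge> 1\<close> by (intro mult_left_mono) auto
    also have "\<dots> = x / (8 * (real k + 3))" using \<open>x \<ge> 1\<close> by simp
    finally show ?thesis by (simp add: field_simps)
  qed
  obtain m0 :: real where m0: "\<And>x. x \<ge> m0 \<Longrightarrow> ln x \<le> (1 / 64) * x" using ln_small[of "1 / 64"] by auto
  define C0 where "C0 = max (max (m0 / 2) 1) (16 * (\<bar>c2\<bar> + 1 + \<bar>c1\<bar>))"
  have C0: "2 * ln (2 * x) + (\<bar>c2\<bar> + 1 + \<bar>c1\<bar>) \<le> x / 8" if "x \<ge> C0" for x
    using m0[of "2 * x"] that by (simp add: C0_def)
  \<comment> \<open>Since Y L is at least 1/2, N is at least C / 2: the entry \<open>2 * N0\<close>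
    gives N \<ge> \<open>N0\<close> and the entry 8 gives N \<ge> 4. The entry \<open>C0\<close>
    handles the term Y ln N together with ln D.\<close>
  define C where "C = Max {C0, 2 * N0, 8}"
  have C: "C \<ge> C0" "C \<ge> 2 * N0" "C \<ge> 8" by (simp_all add: C_def)
  have C8: "2 * ln (2 * C) + (\<bar>c2\<bar> + 1 + \<bar>c1\<bar>) \<le> C / 8"
    by (rule C0[OF C(1)])
  have "real N ^ (nat (\<lceil>Y\<rceil> + \<lceil>sqrt (real N)\<rceil>) + k) * D < 2 ^ (N - 1)"
    if Y: "Y \<ge> 1" and L: "L \<ge> 1 / 2" and lY: "ln Y \<le> c2 * L" and D: "D \<ge> (1::real)" and lD: "ln D \<le> c1 * L"
      and N: "N = nat \<lceil>C * Y * L\<rceil>" for Y L D N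
  proof -
    define U where "U = Y * L"
    define x where "x = real N"
    have U: "U \<ge> 1 / 2" "U \<ge> L" using Y L mult_mono[of 1 Y "1/2" L] mult_right_mono[of 1 Y L] by (simp_all add: U_def)
    have CU: "C * Y * L = C * U" "C * U \<ge> 4" "C * U \<ge> C / 2" using C(3) U mult_mono[of 8 C "1/2" U] mult_left_mono[of "1/2" U C]
      by (auto simp: U_def)
    have "x = of_int \<lceil>C * U\<rceil>" using N CU by (simp add: x_def)
    then have x: "x \<ge> C * U" "x < C * U + 1" by linarith+
    then have x2: "x \<ge> 4" "x \<le> 2 * C * U" using CU(2) by linarith+
    have s: "(real k + 3) * (sqrt x * ln x) \<le> x / 8" using x(1) CU(3) C(2) by (intro N0) linarith
    have "ln x \<le> ln ((2 * C) * (Y * L))" using x2 unfolding U_def by (intro ln_mono) (simp_all add: mult_ac)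
    also have "\<dots> = ln (2 * C) + (ln Y + ln L)" using C(3) Y L by (simp add: ln_mult)
    also have "\<dots> \<le> ln (2 * C) + (c2 * L + L)" using lY L ln_bound[of L] by simp
    finally have "Y * ln x \<le> Y * (ln (2 * C) + (c2 * L + L))" using Y by (intro mult_left_mono) auto
    also have "\<dots> = Y * ln (2 * C) + (c2 + 1) * U" by (simp add: U_def algebra_simps)
    also have "\<dots> \<le> (2 * U) * ln (2 * C) + (\<bar>c2\<bar> + 1) * U"
      using C(3) L Y U unfolding U_def by (intro add_mono mult_right_mono) (auto)
    finally have "Y * ln x \<le> U * (2 * ln (2 * C) + (\<bar>c2\<bar> + 1))" by (simp add: algebra_simps)
    moreover have "ln D \<le> \<bar>c1\<bar> * U"
    proof -
      have "c1 * L \<le> \<bar>c1\<bar> * U" using U(2) L by (intro mult_mono) auto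
      then show ?thesis using lD by linarith
    qed
    ultimately have "Y * ln x + ln D \<le> U * (2 * ln (2 * C) + (\<bar>c2\<bar> + 1 + \<bar>c1\<bar>))" by (simp add: algebra_simps)
    also have "\<dots> \<le> U * (C / 8)" using C8 U by (intro mult_left_mono) auto
    also have "\<dots> \<le> x / 8" using x(1) by (simp add: mult.commute)
    finally have main: "Y * ln x + ln D \<le> x / 8" .
    define e where "e = nat (\<lceil>Y\<rceil> + \<lceil>sqrt x\<rceil>) + k"
    have "sqrt x \<ge> 1" using x2 by simp
    then have "real e \<le> Y + (real k + 3) * sqrt x"
    proof -
      assume sx: "sqrt x \<ge> 1"
      have "0 \<le> \<lceil>Y\<rceil> + \<lceil>sqrt x\<rceil>" using Y sx by linarith
      then have "real e = of_int \<lceil>Y\<rceil> + of_int \<lceil>sqrt x\<rceil> + real k" by (simp add: e_def)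
      then have "real e \<le> Y + 1 + (sqrt x + 1) + real k" by linarith
      moreover have "(real k + 2) * 1 \<le> (real k + 2) * sqrt x" using sx by (intro mult_left_mono) auto
      ultimately show ?thesis by (simp add: algebra_simps)
    qed
    then have "real e * ln x \<le> (Y + (real k + 3) * sqrt x) * ln x" using x2 by (intro mult_right_mono) auto
    then have "real e * ln x + ln D \<le> x / 4" using main s by (simp add: algebra_simps)
    also have "x / 4 < (x - 1) * (1 / 2)" using x2 by simp
    also have "\<dots> \<le> (x - 1) * ln 2" using x2 ln2_ge_half by (intro mult_left_mono) auto
    finally have "ln (x ^ e * D) < ln (2 ^ (N - 1))"
      using x2 D by (simp add: ln_mult ln_realpow x_def of_nat_diff)
    then have "x ^ e * D < 2 ^ (N - 1)" using x2 D by simp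
    then show ?thesis by (simp add: x_def e_def)
  qed
  then show ?thesis using C(3) by (intro exI[of _ C]) auto
qed

text \<open>Everything is compared with an M-th power: (M + 1) d is at most (2d)^M, and the power of
  B2 is below exp(d)^M because \<open>ln B2 \<le> real M\<close>. This produces the constant 2 d
  exp(d), and the exponent on the right is at least d M.\<close>

lemma prime_exceeds_threshold:
  fixes d M :: nat and B1 B2 p :: real
  assumes d: "d \<ge> 1" and M: "M \<ge> 1" "ln B2 \<le> real M" and B: "B1 \<ge> 1" "B2 \<ge> 1"
    and p: "p \<ge> (2 * real d * exp (real d) * B1) powr (2 / real d)"
  shows "real ((M + 1) * d) * (B1 ^ M * B2 ^ (d - 1)) < sqrt p ^ ((M + 1) * d - 1)"
proof -
  define K where "K = 2 * real d * exp (real d)"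
  have K: "K \<ge> 2"
    using d mult_mono[of 2 "2 * real d" 1 "exp (real d)"] by (simp add: K_def)
  have KB: "K * B1 \<ge> 1" using K B mult_mono[of 1 K 1 B1] by simp
  have "M + 1 \<le> 2 ^ M" using less_exp[of M] by (simp add: Suc_le_eq)
  then have "real (M + 1) \<le> 2 ^ M" by (metis of_nat_le_iff of_nat_numeral of_nat_power)
  moreover have "real d \<le> real d ^ M" using d M self_le_power[of "real d" M] by simp
  ultimately have "real ((M + 1) * d) \<le> 2 ^ M * real d ^ M" unfolding of_nat_mult by (intro mult_mono) auto
  also have "\<dots> = (2 * real d) ^ M" by (simp add: power_mult_distrib)
  finally have 1: "real ((M + 1) * d) \<le> (2 * real d) ^ M" .
  have "B2 ^ (d - 1) = exp (ln B2) ^ (d - 1)" using B by simp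
  also have "\<dots> \<le> exp (real M) ^ (d - 1)" using M by (intro power_mono) auto
  also have "\<dots> = exp (real (M * (d - 1)))" by (simp add: exp_of_nat_mult[symmetric] mult.commute)
  also have "\<dots> < exp (real (M * d))" using d M by simp
  also have "\<dots> = exp (real d) ^ M" by (simp add: exp_of_nat_mult[symmetric])
  finally have 2: "B2 ^ (d - 1) < exp (real d) ^ M" .
  have "real ((M + 1) * d) * (B1 ^ M * B2 ^ (d - 1)) < (2 * real d) ^ M * (B1 ^ M * exp (real d) ^ M)"
  proof (intro mult_le_less_imp_less mult_strict_left_mono)
    show "0 < real ((M + 1) * d)" unfolding of_nat_0_less_iff using d by simp
  qed (use 1 2 B in auto)
  also have "\<dots> = (K * B1) ^ M" by (simp add: K_def power_mult_distrib mult_ac)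
  also have "\<dots> \<le> (sqrt p ^ d) ^ M"
  proof (intro power_mono)
    have "K * B1 = ((K * B1) powr (2 / real d)) powr (real d / 2)" using KB d by (simp add: powr_powr)
    also have "\<dots> \<le> p powr (real d / 2)" using p KB by (intro powr_mono2) (auto simp: K_def)
    also have "\<dots> = (p powr (1/2)) powr real d" by (simp add: powr_powr)
    also have "\<dots> = sqrt p ^ d"
    proof -
      have "p > 0" using p KB powr_gt_zero[of "K * B1" "2 / real d"] unfolding K_def by linarith
      then show ?thesis by (simp add: powr_half_sqrt powr_realpow)
    qed
    finally show "K * B1 \<le> sqrt p ^ d" .
  qed (use KB in auto)
  also have "\<dots> = sqrt p ^ (d * M)" by (simp add: power_mult)
  also have "\<dots> \<le> sqrt p ^ ((M + 1) * d - 1)"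
  proof (rule power_increasing)
    show "d * M \<le> (M + 1) * d - 1" using d by (simp add: algebra_simps)
    have "1 \<le> (K * B1) powr (2 / real d)" using KB by (intro ge_one_powr_ge_zero) auto
    then show "1 \<le> sqrt p" using p by (simp add: K_def)
  qed
  finally show ?thesis .
qed

text \<open>The hypothesis \<open>B1 \<le> B2 ^ d2\<close> makes the logarithms of B1, of the
  coefficient bound and of the size of the primes O(ln B2) with constants depending only on the
  parameters.\<close>

lemma count_small_coefficients:
  fixes d1 d2 k0 :: nat and A0 :: real
  assumes d2: "d2 \<ge> 1" and A0: "A0 \<ge> 1"
  shows "\<exists>C\<ge>0. \<forall>f B1 B2 S. irreducible (rat_poly2 f) \<and> degree f = d2 \<and> bideg_le f d1 d2
     \<and> B1 \<ge> 1 \<and> B2 \<ge> 2 \<and> B1 \<le> B2 ^ d2 \<and> coeffs_le f (A0 * (B1 * B2) ^ k0)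
     \<and> (\<forall>(x, y)\<in>S. eval_xy (rat_poly2 f) x y = 0 \<and> real_of_int (rat_height x) \<le> B1 \<and> real_of_int (rat_height y) \<le> B2)
     \<longrightarrow> real (card S) \<le> C * B1 powr (2 / real d2) * (ln B2)\<^sup>2"
proof -
  obtain A k where A: "A \<ge> 1" and disc: "\<And>f H. irreducible (rat_poly2 f) \<and> degree f = d2 \<and> bideg_le f d1 d2 \<and> coeffs_le f H \<and> H \<ge> 1
     \<longrightarrow> (\<exists>a b R. a * f + b * pderiv f = [:R:] \<and> degree (R * lead_coeff f) \<le> (2 * d2 + 2) * d1
           \<and> R * lead_coeff f \<noteq> 0 \<and> \<bar>real_of_int (lead_coeff (R * lead_coeff f))\<bar> \<le> A * H ^ k)"
    using discriminant_exists[OF d2, of d1] by blast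
  define K where "K = 2 * real d2 * exp (real d2)"
  have K: "K \<ge> 2"
    using d2 mult_mono[of 2 "2 * real d2" 1 "exp (real d2)"] by (simp add: K_def)
  \<comment> \<open>Constants are absorbed into multiples of L = ln B2 by 1 \<le> 2 L, hence the
    factors 2; ln B1 is replaced by \<open>d2\<close> times L.\<close>
  define c1 where "c1 = 2 * ln (A * A0 ^ k) + real (k0 * k) * (real d2 + 1)"
  define c2 where "c2 = (2 / real d2) * (2 * ln K + real d2)"
  obtain C where C: "C \<ge> 1" and est: "\<And>Y L D. Y \<ge> 1 \<Longrightarrow> L \<ge> 1 / 2 \<Longrightarrow> ln Y \<le> c2 * L \<Longrightarrow> D \<ge> (1::real) \<Longrightarrow> ln D \<le> c1 * L \<Longrightarrow>
     real (nat \<lceil>C * Y * L\<rceil>) ^ (nat (\<lceil>Y\<rceil> + \<lceil>sqrt (real (nat \<lceil>C * Y * L\<rceil>))\<rceil>) + d2) * D < 2 ^ (nat \<lceil>C * Y * L\<rceil> - 1)"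
    using prime_range_estimate[of c2 c1 d2] by blast
  define Dg where "Dg = (2 * d2 + 2) * d1"
  define C' where "C' = real d2 * (3 * C * K powr (2 / real d2) * real d2 * ((2 * real d2 + 1) * (3 + 2 * real d1) * real d2))
     + 4 * real ((Dg + 1) ^ d2 * d2)"
  have "C' \<ge> 0" unfolding C'_def using C by (intro add_nonneg_nonneg mult_nonneg_nonneg) auto
  moreover have "real (card S) \<le> C' * B1 powr (2 / real d2) * (ln B2)\<^sup>2"
    if f: "irreducible (rat_poly2 f)" "degree f = d2" "bideg_le f d1 d2"
      and B: "B1 \<ge> 1" "B2 \<ge> 2" "B1 \<le> B2 ^ d2" and cf: "coeffs_le f (A0 * (B1 * B2) ^ k0)"
      and S: "\<forall>(x, y)\<in>S. eval_xy (rat_poly2 f) x y = 0 \<and> real_of_int (rat_height x) \<le> B1 \<and> real_of_int (rat_height y) \<le> B2"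
    for f B1 B2 S
  proof -
    define L where "L = ln B2"
    have "ln 2 \<le> L" using B by (simp add: L_def)
    then have L: "L \<ge> 1 / 2" using ln2_ge_half by linarith
    have lB1: "0 \<le> ln B1" "ln B1 \<le> real d2 * L"
      using B ln_mono[of B1 "B2 ^ d2"] by (simp_all add: L_def ln_realpow)
    define H where "H = A0 * (B1 * B2) ^ k0"
    have BB: "B1 * B2 \<ge> 1" using B mult_mono[of 1 B1 1 B2] by simp
    have H: "H \<ge> 1" using A0 one_le_power[OF BB, of k0] mult_mono[of 1 A0 1 "(B1 * B2) ^ k0"] by (simp add: H_def)
    obtain a b R where R: "a * f + b * pderiv f = [:R:]" "degree (R * lead_coeff f) \<le> Dg"
      "R * lead_coeff f \<noteq> 0" "\<bar>real_of_int (lead_coeff (R * lead_coeff f))\<bar> \<le> A * H ^ k"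
      using disc[of f H] f cf H unfolding Dg_def H_def by blast
    define W where "W = R * lead_coeff f"
    \<comment> \<open>Primes prime to this one coefficient are the ones modulo which
      \<open>W\<close> is nonzero.\<close>
    define D where "D = nat \<bar>lead_coeff W\<bar>"
    have D0: "D > 0" using R(3) by (simp add: D_def W_def)
    have Dr: "real D \<le> A * H ^ k" using R(4) by (simp add: D_def W_def)
    have "ln (real D) \<le> ln (A * H ^ k)" using Dr D0 by (intro ln_mono) auto
    also have "A * H ^ k = (A * A0 ^ k) * (B1 * B2) ^ (k0 * k)"
      by (simp add: H_def power_mult_distrib power_mult)
    also have "ln \<dots> = ln (A * A0 ^ k) + real (k0 * k) * (ln B1 + L)"
      using A A0 B BB by (simp add: ln_mult ln_realpow L_def)
    also have "\<dots> \<le> 2 * ln (A * A0 ^ k) * L + real (k0 * k) * (real d2 * L + L)"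
    proof (intro add_mono mult_left_mono)
      have "A * A0 ^ k \<ge> 1" using A one_le_power[OF A0, of k] mult_mono[of 1 A 1 "A0 ^ k"] by simp
      then have "0 \<le> ln (A * A0 ^ k)" by (rule ln_ge_zero)
      then show "ln (A * A0 ^ k) \<le> 2 * ln (A * A0 ^ k) * L" using L mult_left_mono[of 1 "2 * L" "ln (A * A0 ^ k)"] by simp
    qed (use lB1 in auto)
    also have "\<dots> = c1 * L" by (simp add: c1_def algebra_simps)
    finally have lD: "ln (real D) \<le> c1 * L" .
    define Y where "Y = (K * B1) powr (2 / real d2)"
    have KB: "K * B1 \<ge> 2" using K B mult_mono[of 2 K 1 B1] by simp
    have Y: "Y \<ge> 1" unfolding Y_def using KB by (intro ge_one_powr_ge_zero) auto
    have "ln Y = (2 / real d2) * (ln K + ln B1)" using K B by (simp add: Y_def ln_powr ln_mult)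
    also have "\<dots> \<le> (2 / real d2) * (2 * ln K * L + real d2 * L)"
    proof (intro mult_left_mono add_mono)
      have "0 \<le> ln K" using K by simp
      then show "ln K \<le> 2 * ln K * L" using L mult_left_mono[of 1 "2 * L" "ln K"] by simp
    qed (use lB1 in auto)
    also have "\<dots> = c2 * L" by (simp add: c2_def algebra_simps)
    finally have lY: "ln Y \<le> c2 * L" .
    define N where "N = nat \<lceil>C * Y * L\<rceil>"
    \<comment> \<open>Exceeding Y makes a prime large enough for the auxiliary polynomial; exceeding
      the root of N gives \<open>N \<le> Y'\<^sup>2\<close>.\<close>
    define Y' where "Y' = nat (\<lceil>Y\<rceil> + \<lceil>sqrt (real N)\<rceil>)"
    have "real (N ^ (Y' + d2) * D) < real (2 ^ (N - 1))"
      using est[OF Y L lY _ lD] D0 by (simp add: N_def Y'_def)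
    then have small: "N ^ (Y' + d2) * D < 2 ^ (N - 1)" by (simp only: of_nat_less_iff)
    have CYL: "C * Y * L > 0" using C Y L by simp
    have N1: "N \<ge> 1" using CYL by (simp add: N_def Suc_le_eq)
    have "real N \<le> C * Y * L + 1" using CYL unfolding N_def by linarith
    moreover have CYL2: "C * Y * L \<ge> 1 / 2"
      using C Y L mult_mono[of 1 "C * Y" "1/2" L] mult_mono[of 1 C 1 Y] by simp
    ultimately have N2: "real N \<le> 3 * (C * Y * L)" by linarith
    have Y'r: "Y \<le> real Y'" "sqrt (real N) \<le> real Y'"
      using Y real_sqrt_ge_zero[of "real N"] unfolding Y'_def by linarith+
    have "real N \<le> (real Y')\<^sup>2" by (rule sqrt_le_D[OF Y'r(2)])
    then have "N \<le> Y'\<^sup>2" by (metis of_nat_le_iff of_nat_power)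
    from obtain_subset_with_card_n[OF less_imp_le[OF card_primes_not_dvd[OF N1 this D0 small]]]
    obtain P where P: "P \<subseteq> {p. prime p \<and> Y' < p \<and> p \<le> N \<and> \<not> p dvd D}" "card P = d2" "finite P"
      by auto
    have PY: "Y \<le> real p" if "p \<in> P" for p using P(1) that Y'r(1) by fastforce
    have Pp: "prime p \<and> p \<le> N \<and> (\<exists>i. \<not> int p dvd coeff (R * lead_coeff f) i)" if "p \<in> P" for p
    proof -
      have "\<not> p dvd nat \<bar>lead_coeff W\<bar>" using P(1) that by (auto simp: D_def)
      then have "\<not> int p dvd lead_coeff W" by (simp add: int_dvd_int_iff[symmetric])
      then show ?thesis using P(1) that unfolding W_def by blast
    qed
    define M where "M = nat \<lceil>L\<rceil>"
    have M: "M \<ge> 1" "L \<le> real M" "real M \<le> L + 1" using L unfolding M_def by linarith+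
    \<comment> \<open>Each of the \<open>d2\<close> primes is at least
      \<open>(K * B1) powr (2 / real d2)\<close>, so the product is at least
      \<open>(K * B1)\<^sup>2\<close>, and \<open>K \<ge> 2\<close>.\<close>
    have prod: "2 * B1\<^sup>2 < real (\<Prod>P)"
    proof -
      have "2 * B1\<^sup>2 < (2 * B1)\<^sup>2" using B by (simp add: power_mult_distrib)
      also have "\<dots> \<le> (K * B1)\<^sup>2" using K B by (intro power_mono mult_right_mono) auto
      also have "\<dots> = Y ^ d2"
      proof -
        have "Y ^ d2 = Y powr real d2" using Y by (simp add: powr_realpow)
        also have "\<dots> = (K * B1) powr 2" using d2 by (simp add: Y_def powr_powr)
        finally show ?thesis using KB by simp
      qed
      also have "\<dots> = (\<Prod>p\<in>P. Y)" by (simp add: P(2))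
      also have "\<dots> \<le> (\<Prod>p\<in>P. real p)" using PY Y by (intro prod_mono) auto
      finally show ?thesis by simp
    qed
    have big: "real ((M + 1) * d2) * (B1 ^ M * B2 ^ (d2 - 1)) < sqrt (real p) ^ ((M + 1) * d2 - 1)" if "p \<in> P" for p
      using PY[OF that] M B d2 by (intro prime_exceeds_threshold) (auto simp: Y_def K_def L_def)
    have S': "eval_xy (rat_poly2 f) x y = 0 \<and> real_of_int (rat_height x) \<le> B1 \<and> real_of_int (rat_height y) \<le> B2"
      if "(x, y) \<in> S" for x y using S that by auto
    have B2': "B2 \<ge> 1" using B by simp
    have "card S \<le> card P * (N * d2 * (((2 * d2 + 1) * (M + d1)) * d2)) + (Dg + 1) ^ card P * d2"
      by (rule counting_with_primes[OF f(1,2) d2 f(3) R(1,2) P(3) Pp B(1) B2' big prod S'])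
    then have "real (card S) \<le> real (d2 * (N * d2 * (((2 * d2 + 1) * (M + d1)) * d2)) + (Dg + 1) ^ d2 * d2)"
      unfolding P(2) of_nat_le_iff .
    also have "\<dots> = real d2 * (real N * real d2 * ((2 * real d2 + 1) * (real M + real d1) * real d2)) + real ((Dg + 1) ^ d2 * d2)"
      by (simp add: algebra_simps)
    also have "\<dots> \<le> real d2 * ((3 * (C * Y * L)) * real d2 * ((2 * real d2 + 1) * ((3 + 2 * real d1) * L) * real d2))
        + 4 * real ((Dg + 1) ^ d2 * d2) * (B1 powr (2 / real d2) * L\<^sup>2)"
    proof (intro add_mono mult_left_mono mult_mono)
      show "real N \<le> 3 * (C * Y * L)" by (rule N2)
      have "real d1 * 1 \<le> real d1 * (2 * L)" using L by (intro mult_left_mono) auto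
      then show "real M + real d1 \<le> (3 + 2 * real d1) * L" using M(3) L by (simp add: algebra_simps)
      have "1 \<le> B1 powr (2 / real d2)" using B by (intro ge_one_powr_ge_zero) auto
      moreover have "(1 / 2)\<^sup>2 \<le> L\<^sup>2" using L by (intro power_mono) auto
      ultimately have "1 * (1 / 4) \<le> B1 powr (2 / real d2) * L\<^sup>2" by (intro mult_mono) (auto simp: power2_eq_square)
      then have "real ((Dg + 1) ^ d2 * d2) * 1 \<le> real ((Dg + 1) ^ d2 * d2) * (4 * (B1 powr (2 / real d2) * L\<^sup>2))"
        by (intro mult_left_mono) auto
      then show "real ((Dg + 1) ^ d2 * d2) \<le> 4 * real ((Dg + 1) ^ d2 * d2) * (B1 powr (2 / real d2) * L\<^sup>2)"
        by (simp add: mult_ac)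
    qed (use L CYL in auto)
    also have "\<dots> = C' * B1 powr (2 / real d2) * L\<^sup>2"
    proof -
      have "Y = K powr (2 / real d2) * B1 powr (2 / real d2)" unfolding Y_def using K B by (simp add: powr_mult)
      then show ?thesis by (simp add: C'_def algebra_simps power2_eq_square)
    qed
    finally show ?thesis by (simp add: L_def)
  qed
  ultimately show ?thesis by (intro exI[of _ C'] conjI) (auto simp only:)
qed

lemma degX1_witness:
  assumes "f \<noteq> 0" "degX1 f = d1"
  shows "bideg_le f d1 (degree f)" "\<exists>j. degree (coeff f j) = d1 \<and> coeff f j \<noteq> 0"
proof -
  define A where "A = (\<lambda>i. degree (coeff f i)) ` {..degree f}"
  have A: "finite A" "A \<noteq> {}" "Max A = d1" using assms(2) by (auto simp: A_def degX1_def)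
  have le: "degree (coeff f j) \<le> d1" for j
  proof (cases "j \<le> degree f")
    case True
    then have "degree (coeff f j) \<in> A" by (auto simp: A_def)
    then show ?thesis using A Max_ge by metis
  qed (simp add: coeff_eq_0)
  then show "bideg_le f d1 (degree f)" by (simp add: bideg_le_def)
  have "d1 \<in> A" using Max_in[OF A(1,2)] A(3) by simp
  then obtain j where j: "degree (coeff f j) = d1" by (auto simp: A_def)
  show "\<exists>j. degree (coeff f j) = d1 \<and> coeff f j \<noteq> 0"
  \<comment> \<open>For \<open>d1 = 0\<close> the maximum may be attained at a zero coefficient,
    which has degree 0 by convention; the leading coefficient then serves.\<close>
  proof (cases "coeff f j = 0")
    case True
    then have "degree (lead_coeff f) = d1" using j le[of "degree f"] by simp
    then show ?thesis using assms(1) by (intro exI[of _ "degree f"]) simp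
  qed (use j in blast)
qed

theorem theorem1p4:
  shows "\<forall>d1 d2. d2 \<ge> 1 \<longrightarrow> (\<exists>c>0. \<forall>f B1 B2.
     irreducible_over_Q f \<and> degX1 f = d1 \<and> degX2 f = d2 \<and> B1 \<ge> 1 \<and> B2 \<ge> 2 \<longrightarrow>
     real (N_rat f B1 B2) \<le> c * B1 powr (2 / real d2) * (ln B2)\<^sup>2)"
proof (intro allI impI)
  fix d1 d2 :: nat
  assume d2: "d2 \<ge> 1"
  define n where "n = (d1 + 1) * (d2 + 1)"
  obtain A k where A: "A \<ge> 1" "\<And>H. H \<ge> 1 \<Longrightarrow> kernel_bound n H \<le> A * H ^ k"
    using kernel_bound_polynomial[of n] by blast
  obtain C where C: "C \<ge> 0" and count: "\<And>f B1 B2 S. irreducible (rat_poly2 f) \<and> degree f = d2 \<and> bideg_le f d1 d2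
     \<and> B1 \<ge> 1 \<and> B2 \<ge> 2 \<and> B1 \<le> B2 ^ d2 \<and> coeffs_le f (A * (B1 * B2) ^ ((d1 + d2) * k))
     \<and> (\<forall>(x, y)\<in>S. eval_xy (rat_poly2 f) x y = 0 \<and> real_of_int (rat_height x) \<le> B1 \<and> real_of_int (rat_height y) \<le> B2)
     \<Longrightarrow> real (card S) \<le> C * B1 powr (2 / real d2) * (ln B2)\<^sup>2"
    using count_small_coefficients[OF d2 A(1), of d1 "(d1 + d2) * k"] by blast
  define E where "E = ((2 * d2 + 1) * d1) * d2"
  \<comment> \<open>The bounds of all cases are added. Where no logarithm arises,
    \<open>(ln B2)\<^sup>2 \<ge> 1 / 4\<close> costs a factor 4; 12 is this factor times the 3 of
    \<open>card_rat_height_le\<close>.\<close>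
  define c where "c = 12 + 12 * real d1 + 4 * real E + C"
  have "real (N_rat f B1 B2) \<le> c * B1 powr (2 / real d2) * (ln B2)\<^sup>2"
    if f: "irreducible_over_Q f" "degX1 f = d1" "degX2 f = d2" and B: "B1 \<ge> 1" "B2 \<ge> 2" for f B1 B2
  proof -
    define S where "S = {(x, y). eval_xy (rat_poly2 f) x y = 0 \<and> real_of_int (rat_height x) \<le> B1 \<and> real_of_int (rat_height y) \<le> B2}"
    have NS: "N_rat f B1 B2 = card S" by (simp add: N_rat_def S_def eval2_conv_eval_xy)
    have irr: "irreducible (rat_poly2 f)" using f(1) by (simp add: irreducible_over_Q_def)
    have deg: "degree f = d2" using f(3) by (simp add: degX2_def)
    have f0: "f \<noteq> 0" using irr by auto
    obtain j1 where bi: "bideg_le f d1 d2" and j1: "degree (coeff f j1) = d1" "coeff f j1 \<noteq> 0"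
      using degX1_witness[OF f0 f(2)] deg by blast
    define Q where "Q = B1 powr (2 / real d2) * (ln B2)\<^sup>2"
    have P1: "1 \<le> B1 powr (2 / real d2)" using B by (intro ge_one_powr_ge_zero) auto
    have "ln 2 \<le> ln B2" using B by simp
    then have "1 / 2 \<le> ln B2" using ln2_ge_half by linarith
    then have "(1 / 2)\<^sup>2 \<le> (ln B2)\<^sup>2" by (intro power_mono) auto
    then have l: "1 / 4 \<le> (ln B2)\<^sup>2" by (simp add: power2_eq_square)
    then have PQ: "B1 powr (2 / real d2) \<le> 4 * Q"
      using P1 mult_left_mono[OF l, of "B1 powr (2 / real d2)"] by (simp add: Q_def)
    have Q0: "Q \<ge> 0" using P1 by (simp add: Q_def)
    have "real (card S) \<le> (12 + 12 * real d1 + 4 * real E + C) * Q"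
    proof -
      \<comment> \<open>For \<open>d2 = 1\<close> the claimed power is \<open>B1\<^sup>2\<close>,
        the number of x_1 up to a constant. For B1 > B2^d2 counting the x_2 is enough, but the bound
        on horizontal fibres needs \<open>d2 \<ge> 2\<close>. The last case makes ln B1 at most
        \<open>d2\<close> times ln B2.\<close>
      consider "d2 = 1" | "d2 \<ge> 2" "B1 > B2 ^ d2" | "B1 \<le> B2 ^ d2" using d2 by linarith
      then have "real (card S) \<le> 12 * Q \<or> real (card S) \<le> 12 * real d1 * Q \<or> real (card S) \<le> 4 * real E * Q \<or> real (card S) \<le> C * Q"
      proof cases
        case 1
        have "S \<subseteq> Sigma {x. real_of_int (rat_height x) \<le> B1} (\<lambda>x. {y. eval_xy (rat_poly2 f) x y = 0})"
          by (auto simp: S_def)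
        moreover have "finite {y. eval_xy (rat_poly2 f) x y = 0} \<and> card {y. eval_xy (rat_poly2 f) x y = 0} \<le> 1" for x
          using card_section_le[OF irr, of x] deg 1 by simp
        ultimately have "card S \<le> card {x. real_of_int (rat_height x) \<le> B1} * 1"
          by (intro card_fibration_le(2)[OF card_rat_height_le(1)[OF B(1)] order_refl]) auto
        then have "real (card S) \<le> 3 * B1\<^sup>2" using card_rat_height_le(2)[OF B(1)] by linarith
        also have "B1\<^sup>2 = B1 powr (2 / real d2)" using B 1 by simp
        finally show ?thesis using PQ by linarith
      next
        case 2
        have B2: "B2 \<ge> 1" using B by simp
        have "prod.swap ` S \<subseteq> Sigma {y. real_of_int (rat_height y) \<le> B2} (\<lambda>y. {x. eval_xy (rat_poly2 f) x y = 0})"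
          by (auto simp: S_def)
        moreover have "finite {x. eval_xy (rat_poly2 f) x y = 0} \<and> card {x. eval_xy (rat_poly2 f) x y = 0} \<le> d1" for y
          using card_cosection_le[OF irr, of d1 d2 y] deg 2 bi by simp
        ultimately have "card (prod.swap ` S) \<le> card {y. real_of_int (rat_height y) \<le> B2} * d1"
          by (intro card_fibration_le(2)[OF card_rat_height_le(1)[OF B2] order_refl]) auto
        then have "card S \<le> card {y. real_of_int (rat_height y) \<le> B2} * d1" by (simp add: card_image)
        then have "real (card S) \<le> real (card {y. real_of_int (rat_height y) \<le> B2}) * real d1"
          by (metis of_nat_le_iff of_nat_mult)
        also have "\<dots> \<le> 3 * B2\<^sup>2 * real d1" using card_rat_height_le(2)[OF B2] by (intro mult_right_mono) auto
        also have "B2\<^sup>2 = (B2 ^ d2) powr (2 / real d2)"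
        proof -
          have "B2 ^ d2 = B2 powr real d2" using B by (intro powr_realpow[symmetric]) simp
          then have "(B2 ^ d2) powr (2 / real d2) = B2 powr 2" using d2 by (simp add: powr_powr)
          then show ?thesis using B by simp
        qed
        also have "3 * (B2 ^ d2) powr (2 / real d2) * real d1 \<le> 3 * (4 * Q) * real d1"
        proof (intro mult_left_mono mult_right_mono)
          have "(B2 ^ d2) powr (2 / real d2) \<le> B1 powr (2 / real d2)" using 2 B by (intro powr_mono2) auto
          then show "(B2 ^ d2) powr (2 / real d2) \<le> 4 * Q" using PQ by linarith
        qed auto
        finally show ?thesis by (simp add: mult_ac)
      next
        case 3
        have B2: "B2 \<ge> 1" using B by simp
        have S: "eval_xy (rat_poly2 f) x y = 0 \<and> real_of_int (rat_height x) \<le> B1 \<and> real_of_int (rat_height y) \<le> B2"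
          if "(x, y) \<in> S" for x y using that by (simp add: S_def)
        have "card S \<le> ((2 * d2 + 1) * d1) * d2 \<or>
          (\<exists>g. irreducible (rat_poly2 g) \<and> degree g = d2 \<and> bideg_le g d1 d2
             \<and> coeffs_le g (kernel_bound ((d1 + 1) * (d2 + 1)) (B1 ^ d1 * B2 ^ d2))
             \<and> (\<forall>(x, y)\<in>S. eval_xy (rat_poly2 g) x y = 0))"
          by (rule small_height_equation[OF irr deg d2 bi j1 B(1) B2]) (rule S)
        then show ?thesis
        proof (elim disjE exE conjE)
          assume "card S \<le> ((2 * d2 + 1) * d1) * d2"
          then have "real (card S) \<le> real E" unfolding E_def of_nat_le_iff .
          also have "\<dots> \<le> real E * (4 * Q)" using P1 PQ mult_left_mono[of 1 "4 * Q" "real E"] by simp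
          finally show ?thesis by (simp add: mult_ac)
        next
          \<comment> \<open>All points of \<open>S\<close> lie on \<open>g\<close>, whose
            coefficients are polynomial in B1 B2, so the count is applied to \<open>g\<close> in
            place of \<open>f\<close>.\<close>
          fix g
          assume g: "irreducible (rat_poly2 g)" "degree g = d2" "bideg_le g d1 d2"
            "coeffs_le g (kernel_bound ((d1 + 1) * (d2 + 1)) (B1 ^ d1 * B2 ^ d2))"
            "\<forall>(x, y)\<in>S. eval_xy (rat_poly2 g) x y = 0"
          define H where "H = B1 ^ d1 * B2 ^ d2"
          have H: "H \<ge> 1" using B mult_mono[of 1 "B1 ^ d1" 1 "B2 ^ d2"] by (simp add: H_def)
          have "H \<le> B1 ^ (d1 + d2) * B2 ^ (d1 + d2)"
            unfolding H_def using B by (intro mult_mono power_increasing) auto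
          then have "H ^ k \<le> ((B1 * B2) ^ (d1 + d2)) ^ k"
            using H by (intro power_mono) (auto simp: power_mult_distrib)
          then have "A * H ^ k \<le> A * (B1 * B2) ^ ((d1 + d2) * k)"
            using A(1) by (simp add: power_mult)
          then have "kernel_bound n H \<le> A * (B1 * B2) ^ ((d1 + d2) * k)" using A(2)[OF H] by linarith
          then have "coeffs_le g (A * (B1 * B2) ^ ((d1 + d2) * k))"
            using g(4) unfolding n_def H_def by (rule coeffs_le_mono[rotated])
          moreover have "\<forall>(x, y)\<in>S. eval_xy (rat_poly2 g) x y = 0 \<and> real_of_int (rat_height x) \<le> B1 \<and> real_of_int (rat_height y) \<le> B2"
            using g(5) S by fast
          ultimately have "real (card S) \<le> C * B1 powr (2 / real d2) * (ln B2)\<^sup>2"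
            using g(1-3) B 3 by (intro count) simp
          then show ?thesis by (simp add: Q_def mult.assoc)
        qed
      qed
      moreover have "0 \<le> 12 * Q" "0 \<le> 12 * real d1 * Q" "0 \<le> 4 * real E * Q" "0 \<le> C * Q" using Q0 C by auto
      moreover have "(12 + 12 * real d1 + 4 * real E + C) * Q = 12 * Q + 12 * real d1 * Q + 4 * real E * Q + C * Q"
        by (simp add: algebra_simps)
      ultimately show ?thesis by linarith
    qed
    then show ?thesis by (simp add: NS c_def Q_def mult.assoc)
  qed
  moreover have "c > 0" using C by (simp add: c_def)
  ultimately show "\<exists>c>0. \<forall>f B1 B2.
     irreducible_over_Q f \<and> degX1 f = d1 \<and> degX2 f = d2 \<and> B1 \<ge> 1 \<and> B2 \<ge> 2 \<longrightarrow>
     real (N_rat f B1 B2) \<le> c * B1 powr (2 / real d2) * (ln B2)\<^sup>2" by blast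
qed

end
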